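(* Let $\Gamma$ be a graph. For each integer $i\ge 0$, the number of conjugacy classes of $\mathbf G_\Gamma(\mathbf F_q)$ of size $q^i$ is given by a polynomial in $q-1$ with non-negative integer coefficients; that is, there exists a polynomial $g_{\Gamma,i}(T)\in\mathbf Z[T]$ with non-negative coefficients such that for every prime power $q$, the number of conjugacy classes of size $q^i$ of $\mathbf G_\Gamma(\mathbf F_q)$ equals $g_{\Gamma,i}(q-1)$.
   Context: Graphs are finite, simple, and have at least one vertex; $\sim$ denotes adjacency; rings are associative, commutative, and unital; group commutators are $[x,y]=x^{-1}y^{-1}xy$. Graphical groups: let $\Gamma=(V,E)$ be a graph with vertices $V=\{v_1,\dotsc,v_n\}$ and let $J=\{(j,k):1\le j<k\le n,\ v_j\sim v_k\}$. For a ring $R$, $\mathbf G_\Gamma(R)$ is the group generated by symbols $x_1(r),\dotsc,x_n(r)$ and $z_{jk}(r)$ for $(j,k)\in J$, $r\in R$, subject to the defining relations (for all $i,i'\in\{1,\dotsc,n\}$, $(j,k),(j',k')\in J$, $r,r'\in R$): $x_i(r)x_i(r')=x_i(r+r')$ and $z_{jk}(r)z_{jk}(r')=z_{jk}(r+r')$; $[x_j(r),x_k(r')]=z_{jk}(rr')$; $[x_i(r),x_{i'}(r')]=1$ if $v_i\not\sim v_{i'}$; $[x_i(r),z_{jk}(r')]=[z_{j'k'}(r),z_{jk}(r')]=1$. The size of every conjugacy class of $\mathbf G_\Gamma(\mathbf F_q)$ is a power of $q$. *)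

theory Defs
  imports
    "HOL-Algebra.Group_Action"
    "HOL-Algebra.Ring"
    "HOL-Computational_Algebra.Polynomial"
    "HOL-Number_Theory.Prime_Powers"
    "Graph_Theory.Pair_Digraph"
begin

section \<open>Groups given by generators and relations\<close>

text \<open>
  The letter \<open>(s, True)\<close> stands for the generator \<open>s\<close> and \<open>(s, False)\<close> for its formal inverse.
\<close>

type_synonym 's gword = "('s \<times> bool) list"

definition gwords :: "'s set \<Rightarrow> 's gword set"
  where "gwords S = lists (S \<times> UNIV)"

definition letter :: "'s \<Rightarrow> 's gword"
  where "letter s = [(s, True)]"

definition inv_word :: "'s gword \<Rightarrow> 's gword"
  where "inv_word w = rev (map (\<lambda>(s, b). (s, \<not> b)) w)"

definition comm_word :: "'s gword \<Rightarrow> 's gword \<Rightarrow> 's gword"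
  where "comm_word u w = inv_word u @ inv_word w @ u @ w"

text \<open>
  The least congruence on the monoid of words over \<open>S\<close> that identifies \<open>s s\<^sup>-\<^sup>1\<close> and \<open>s\<^sup>-\<^sup>1 s\<close> with
  the empty word, and \<open>u\<close> with \<open>w\<close> for every relation \<open>(u, w) \<in> Q\<close>.
\<close>

inductive word_eq :: "'s set \<Rightarrow> ('s gword \<times> 's gword) set \<Rightarrow> 's gword \<Rightarrow> 's gword \<Rightarrow> bool"
  for S Q where
  refl: "w \<in> gwords S \<Longrightarrow> word_eq S Q w w"
| sym: "word_eq S Q u w \<Longrightarrow> word_eq S Q w u"
| trans: "word_eq S Q u v \<Longrightarrow> word_eq S Q v w \<Longrightarrow> word_eq S Q u w"
| append: "word_eq S Q u u' \<Longrightarrow> word_eq S Q w w' \<Longrightarrow> word_eq S Q (u @ w) (u' @ w')"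
| cancel: "s \<in> S \<Longrightarrow> word_eq S Q [(s, b), (s, \<not> b)] []"
| rel: "(u, w) \<in> Q \<Longrightarrow> u \<in> gwords S \<Longrightarrow> w \<in> gwords S \<Longrightarrow> word_eq S Q u w"

definition word_class :: "'s set \<Rightarrow> ('s gword \<times> 's gword) set \<Rightarrow> 's gword \<Rightarrow> 's gword set"
  where "word_class S Q w = {w'. word_eq S Q w w'}"

definition presented_group :: "'s set \<Rightarrow> ('s gword \<times> 's gword) set \<Rightarrow> 's gword set monoid"
  where "presented_group S Q =
    \<lparr> carrier = word_class S Q ` gwords S,
      monoid.mult = (\<lambda>A B. \<Union>a\<in>A. \<Union>b\<in>B. word_class S Q (a @ b)),
      one = word_class S Q [] \<rparr>"

lemma word_eq_gwords:
  assumes "word_eq S Q u w"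
  shows "u \<in> gwords S \<and> w \<in> gwords S"
  using assms by induction (auto simp: gwords_def)

lemma gwords_append: "u \<in> gwords S \<Longrightarrow> w \<in> gwords S \<Longrightarrow> u @ w \<in> gwords S"
  by (simp add: gwords_def)

lemma inv_word_gwords: "w \<in> gwords S \<Longrightarrow> inv_word w \<in> gwords S"
  by (auto simp: gwords_def inv_word_def)

lemma word_class_eq_iff:
  assumes "u \<in> gwords S"
  shows "word_class S Q u = word_class S Q w \<longleftrightarrow> word_eq S Q u w"
  using assms by (auto simp: word_class_def intro: word_eq.intros)

lemma presented_mult:
  assumes "u \<in> gwords S" "w \<in> gwords S"
  shows "word_class S Q u \<otimes>\<^bsub>presented_group S Q\<^esub> word_class S Q w = word_class S Q (u @ w)"
  using assms unfolding presented_group_def word_class_def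
  by (auto intro: word_eq.intros)

lemma word_eq_inv_word:
  assumes "w \<in> gwords S"
  shows "word_eq S Q (inv_word w @ w) []"
  using assms
proof (induction w)
  case Nil
  show ?case by (simp add: inv_word_def gwords_def word_eq.refl)
next
  case (Cons a w)
  obtain s b where a: "a = (s, b)" by fastforce
  have s: "s \<in> S" and w: "w \<in> gwords S" using Cons.prems a by (auto simp: gwords_def)
  have "word_eq S Q ([(s, \<not> b), (s, b)] @ w) ([] @ w)"
    using word_eq.append[OF word_eq.cancel[OF s, of Q "\<not> b"] word_eq.refl[OF w]] by simp
  then have "word_eq S Q (inv_word w @ ([(s, \<not> b), (s, b)] @ w)) (inv_word w @ w)"
    using word_eq.append[OF word_eq.refl[OF inv_word_gwords[OF w]]] by fastforce
  then have "word_eq S Q (inv_word (a # w) @ (a # w)) (inv_word w @ w)"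
    by (simp add: inv_word_def a)
  then show ?case using Cons.IH[OF w] word_eq.trans by blast
qed

theorem group_presented_group: "group (presented_group S Q)"
proof (rule groupI)
  let ?G = "presented_group S Q"
  have car: "x \<in> carrier ?G \<longleftrightarrow> (\<exists>w\<in>gwords S. x = word_class S Q w)" for x
    by (auto simp: presented_group_def)
  have nil: "[] \<in> gwords S" by (simp add: gwords_def)
  have one: "\<one>\<^bsub>?G\<^esub> = word_class S Q []" by (simp add: presented_group_def)
  show "\<one>\<^bsub>?G\<^esub> \<in> carrier ?G" using car one nil by auto
  fix x assume "x \<in> carrier ?G"
  then obtain u where u: "u \<in> gwords S" "x = word_class S Q u" using car by auto
  show "\<one>\<^bsub>?G\<^esub> \<otimes>\<^bsub>?G\<^esub> x = x" using u nil by (simp add: one presented_mult)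
  have "word_class S Q (inv_word u) \<otimes>\<^bsub>?G\<^esub> x = \<one>\<^bsub>?G\<^esub>"
    using u word_eq_inv_word[OF u(1)]
    by (simp add: one presented_mult inv_word_gwords gwords_append word_class_eq_iff)
  then show "\<exists>y\<in>carrier ?G. y \<otimes>\<^bsub>?G\<^esub> x = \<one>\<^bsub>?G\<^esub>"
    using car inv_word_gwords[OF u(1)] by blast
  fix y assume "y \<in> carrier ?G"
  then obtain v where v: "v \<in> gwords S" "y = word_class S Q v" using car by auto
  show "x \<otimes>\<^bsub>?G\<^esub> y \<in> carrier ?G" using u v car by (auto simp: presented_mult gwords_append)
  fix z assume "z \<in> carrier ?G"
  then obtain w where w: "w \<in> gwords S" "z = word_class S Q w" using car by auto
  show "x \<otimes>\<^bsub>?G\<^esub> y \<otimes>\<^bsub>?G\<^esub> z = x \<otimes>\<^bsub>?G\<^esub> (y \<otimes>\<^bsub>?G\<^esub> z)"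
    using u v w by (simp add: presented_mult gwords_append)
qed

text \<open>
  The universal property: a map from \<open>S\<close> to a group \<open>H\<close> under which all relations of \<open>Q\<close> hold
  extends to a homomorphism on the presented group.
\<close>

primrec word_val :: "('b, 'm) monoid_scheme \<Rightarrow> ('s \<Rightarrow> 'b) \<Rightarrow> 's gword \<Rightarrow> 'b" where
  "word_val H f [] = \<one>\<^bsub>H\<^esub>"
| "word_val H f (a # w) = (if snd a then f (fst a) else inv\<^bsub>H\<^esub> (f (fst a))) \<otimes>\<^bsub>H\<^esub> word_val H f w"

theorem presented_group_universal:
  assumes H: "group H" and f: "f \<in> S \<rightarrow> carrier H"
    and Q: "\<And>u w. (u, w) \<in> Q \<Longrightarrow> u \<in> gwords S \<Longrightarrow> w \<in> gwords S \<Longrightarrow> word_val H f u = word_val H f w"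
  shows "\<exists>h \<in> hom (presented_group S Q) H. \<forall>s\<in>S. h (word_class S Q (letter s)) = f s"
proof -
  interpret H: group H by (rule H)
  let ?G = "presented_group S Q"
  have clo: "word_val H f w \<in> carrier H" if "w \<in> gwords S" for w
    using that f by (induction w) (auto simp: gwords_def Pi_iff)
  have app: "word_val H f (u @ w) = word_val H f u \<otimes>\<^bsub>H\<^esub> word_val H f w"
    if "u \<in> gwords S" "w \<in> gwords S" for u w
    using that
  proof (induction u)
    case Nil then show ?case by (simp add: clo)
  next
    case (Cons a u)
    then have "u \<in> gwords S" "fst a \<in> S" by (auto simp: gwords_def)
    with Cons f show ?case by (auto simp: clo H.m_assoc Pi_iff)
  qed
  have eq: "word_val H f u = word_val H f w" if "word_eq S Q u w" for u w
    using that
  proof induction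
    case (append u u' w w')
    then show ?case using app word_eq_gwords by metis
  next
    case (cancel s b)
    then show ?case using f by (cases b) (auto simp: Pi_iff)
  qed (auto simp: Q)
  define h where "h A = word_val H f (SOME w. w \<in> A)" for A
  have h: "h (word_class S Q w) = word_val H f w" if "w \<in> gwords S" for w
  proof -
    have "w \<in> word_class S Q w" using that by (simp add: word_class_def word_eq.refl)
    then have "(SOME w'. w' \<in> word_class S Q w) \<in> word_class S Q w" by (rule someI)
    then show ?thesis unfolding h_def word_class_def using eq by fastforce
  qed
  have "h \<in> hom ?G H"
  proof (rule homI)
    fix x assume "x \<in> carrier ?G"
    then obtain u where u: "u \<in> gwords S" "x = word_class S Q u"
      by (auto simp: presented_group_def)
    show "h x \<in> carrier H" using u h clo by simp
    fix y assume "y \<in> carrier ?G"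
    then obtain w where w: "w \<in> gwords S" "y = word_class S Q w"
      by (auto simp: presented_group_def)
    show "h (x \<otimes>\<^bsub>?G\<^esub> y) = h x \<otimes>\<^bsub>H\<^esub> h y"
      using u w by (simp add: presented_mult gwords_append h app)
  qed
  moreover have "h (word_class S Q (letter s)) = f s" if "s \<in> S" for s
    using that f h[of "letter s"] by (auto simp: letter_def gwords_def Pi_iff)
  ultimately show ?thesis by blast
qed


section \<open>Graphical groups\<close>

datatype 'r graph_gen = Vert nat 'r | Edge nat nat 'r

text \<open>
  Throughout, \<open>v\<close> enumerates the vertices of \<open>\<Gamma>\<close> as \<open>v 1, \<dots>, v n\<close>, where
  \<open>n = card (pverts \<Gamma>)\<close>.
\<close>

definition edge_indices :: "'v pair_pre_digraph \<Rightarrow> (nat \<Rightarrow> 'v) \<Rightarrow> (nat \<times> nat) set"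
  where "edge_indices \<Gamma> v =
    {(j, k). 1 \<le> j \<and> j < k \<and> k \<le> card (pverts \<Gamma>) \<and> (v j, v k) \<in> parcs \<Gamma>}"

definition graph_gens ::
  "'v pair_pre_digraph \<Rightarrow> (nat \<Rightarrow> 'v) \<Rightarrow> ('r, 'm) ring_scheme \<Rightarrow> 'r graph_gen set"
  where "graph_gens \<Gamma> v R =
    {Vert i r | i r. i \<in> {1..card (pverts \<Gamma>)} \<and> r \<in> carrier R} \<union>
    {Edge j k r | j k r. (j, k) \<in> edge_indices \<Gamma> v \<and> r \<in> carrier R}"

definition graph_rels ::
  "'v pair_pre_digraph \<Rightarrow> (nat \<Rightarrow> 'v) \<Rightarrow> ('r, 'm) ring_scheme \<Rightarrow>
    ('r graph_gen gword \<times> 'r graph_gen gword) set"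
  where "graph_rels \<Gamma> v R = (let
      I = {1..card (pverts \<Gamma>)};
      J = edge_indices \<Gamma> v;
      x = (\<lambda>i r. letter (Vert i r));
      z = (\<lambda>j k r. letter (Edge j k r))
    in
      {(x i r @ x i r', x i (r \<oplus>\<^bsub>R\<^esub> r')) | i r r'.
         i \<in> I \<and> r \<in> carrier R \<and> r' \<in> carrier R} \<union>
      {(z j k r @ z j k r', z j k (r \<oplus>\<^bsub>R\<^esub> r')) | j k r r'.
         (j, k) \<in> J \<and> r \<in> carrier R \<and> r' \<in> carrier R} \<union>
      {(comm_word (x j r) (x k r'), z j k (r \<otimes>\<^bsub>R\<^esub> r')) | j k r r'.
         (j, k) \<in> J \<and> r \<in> carrier R \<and> r' \<in> carrier R} \<union>
      {(comm_word (x i r) (x i' r'), []) | i i' r r'.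
         i \<in> I \<and> i' \<in> I \<and> (v i, v i') \<notin> parcs \<Gamma> \<and> r \<in> carrier R \<and> r' \<in> carrier R} \<union>
      {(comm_word (x i r) (z j k r'), []) | i j k r r'.
         i \<in> I \<and> (j, k) \<in> J \<and> r \<in> carrier R \<and> r' \<in> carrier R} \<union>
      {(comm_word (z j' k' r) (z j k r'), []) | j' k' j k r r'.
         (j', k') \<in> J \<and> (j, k) \<in> J \<and> r \<in> carrier R \<and> r' \<in> carrier R})"

definition graphical_group ::
  "'v pair_pre_digraph \<Rightarrow> (nat \<Rightarrow> 'v) \<Rightarrow> ('r, 'm) ring_scheme \<Rightarrow> 'r graph_gen gword set monoid"
  where "graphical_group \<Gamma> v R = presented_group (graph_gens \<Gamma> v R) (graph_rels \<Gamma> v R)"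


section \<open>Conjugacy classes\<close>

definition conjugacy_classes :: "('a, 'm) monoid_scheme \<Rightarrow> 'a set set"
  where "conjugacy_classes G =
    orbits G (carrier G) (\<lambda>g. \<lambda>h\<in>carrier G. g \<otimes>\<^bsub>G\<^esub> h \<otimes>\<^bsub>G\<^esub> inv\<^bsub>G\<^esub> g)"

end

theory Submission
  imports Defs
begin

text \<open>
  Collecting generators shows that \<open>G\<^sub>\<Gamma>(F)\<close> is the Heisenberg-type group on \<open>F\<^sup>I \<times> F\<^sup>J\<close> with
  \<open>[x, y]\<^sub>j\<^sub>k = x\<^sub>j y\<^sub>k - x\<^sub>k y\<^sub>j\<close> for the edges \<open>(j, k) \<in> J\<close>. By the orbit-stabiliser theorem the class of
  \<open>(x, z)\<close> has size \<open>q\<^sup>n / |K|\<close>, where \<open>K\<close> is the kernel of \<open>y \<mapsto> [x, y]\<close>. Its dimension depends only on the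
  support \<open>S\<close> of \<open>x\<close>: it is the number of connected components of the induced subgraph on \<open>S\<close> plus
  the number of vertices outside the closed neighbourhood of \<open>S\<close>. There are \<open>(q - 1)\<^bsup>|S|\<^esup>\<close> vectors \<open>x\<close> with
  support \<open>S\<close>, so the number of classes of size \<open>q\<^sup>i\<close> is the sum of \<open>q\<^bsup>m - i\<^esup> (q - 1)\<^bsup>|S|\<^esup>\<close> over those \<open>S\<close> for
  which the map has rank \<open>i\<close>, where \<open>m = |J|\<close>; finally \<open>q = 1 + (q - 1)\<close>.
\<close>

section \<open>Conjugacy classes in finite groups\<close>

text \<open>The orbit of \<open>x\<close> under conjugation, written without the
  \<open>restrict\<close> that occurs in \<open>conjugacy_classes\<close>.\<close>

definition conj_class :: "('a, 'm) monoid_scheme \<Rightarrow> 'a \<Rightarrow> 'a set"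
  where "conj_class G x = {g \<otimes>\<^bsub>G\<^esub> x \<otimes>\<^bsub>G\<^esub> inv\<^bsub>G\<^esub> g | g. g \<in> carrier G}"

lemma orbit_conjugation_eq_conj_class:
  assumes "x \<in> carrier G"
  shows "orbit G (\<lambda>g. \<lambda>h\<in>carrier G. g \<otimes>\<^bsub>G\<^esub> h \<otimes>\<^bsub>G\<^esub> inv\<^bsub>G\<^esub> g) x = conj_class G x"
  using assms by (auto simp: orbit_def conj_class_def)

lemma conjugacy_classes_eq: "conjugacy_classes G = conj_class G ` carrier G"
  unfolding conjugacy_classes_def orbits_def
  using orbit_conjugation_eq_conj_class by (fastforce simp: image_def)

lemma (in group) conj_class_self:
  assumes "x \<in> carrier G"
  shows "x \<in> conj_class G x"
  using assms unfolding conj_class_def by (intro CollectI exI[of _ \<one>]) auto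

lemma (in group) conj_class_subset: "x \<in> carrier G \<Longrightarrow> conj_class G x \<subseteq> carrier G"
  by (auto simp: conj_class_def)

lemma (in group) conjugacy_classes_disjoint:
  assumes "C \<in> conjugacy_classes G" "D \<in> conjugacy_classes G" "C \<noteq> D"
  shows "C \<inter> D = {}"
  using group_action.disjoint_union[OF action_by_conjugation] assms
  unfolding conjugacy_classes_def by blast

text \<open>Orbit-stabiliser for the conjugation action: the stabiliser of \<open>x\<close> is its
  centraliser.\<close>

lemma (in group) card_conj_class_mult_centralizer:
  assumes "x \<in> carrier G"
  shows "card (conj_class G x) * card {g \<in> carrier G. g \<otimes> x = x \<otimes> g} = Coset.order G"
proof -
  have "stabilizer G (\<lambda>g. \<lambda>h\<in>carrier G. g \<otimes> h \<otimes> inv g) x = {g \<in> carrier G. g \<otimes> x = x \<otimes> g}"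
    unfolding stabilizer_def using assms by (auto simp: inv_solve_right' inv_solve_right)
  then show ?thesis
    using group_action.orbit_stabilizer_theorem[OF action_by_conjugation assms]
      orbit_conjugation_eq_conj_class[OF assms] by simp
qed

text \<open>The classes of size \<open>k\<close> partition the elements whose class has size
  \<open>k\<close>. Counting classes thus reduces to counting elements; the product form avoids a
  division.\<close>

lemma (in group) card_conjugacy_classes_mult:
  assumes "finite (carrier G)"
  shows "card {C \<in> conjugacy_classes G. card C = k} * k
    = card {x \<in> carrier G. card (conj_class G x) = k}"
proof -
  let ?A = "{C \<in> conjugacy_classes G. card C = k}"
  have fin: "finite C" if "C \<in> ?A" for C
    using that assms conj_class_subset finite_subset unfolding conjugacy_classes_eq by blast
  have "\<Union>?A = {x \<in> carrier G. card (conj_class G x) = k}"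
  proof (intro equalityI subsetI)
    fix x assume "x \<in> \<Union>?A"
    then obtain C where C: "C \<in> conjugacy_classes G" "card C = k" "x \<in> C" by blast
    then have x: "x \<in> carrier G" using conj_class_subset unfolding conjugacy_classes_eq by blast
    then have "conj_class G x = C"
      using C conj_class_self[OF x] conjugacy_classes_disjoint[of "conj_class G x" C]
      by (auto simp: conjugacy_classes_eq)
    then show "x \<in> {x \<in> carrier G. card (conj_class G x) = k}" using x C by simp
  qed (use conj_class_self conjugacy_classes_eq in fastforce)
  moreover have "card (\<Union>?A) = sum card ?A"
    using conjugacy_classes_disjoint fin
    by (intro card_Union_disjoint) (auto simp: pairwise_def disjnt_def)
  ultimately show ?thesis by simp
qed

lemma image_conj_class_iso:
  assumes G: "group G" and H: "group H" and h: "h \<in> iso G H" and x: "x \<in> carrier G"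
  shows "h ` conj_class G x = conj_class H (h x)"
proof -
  interpret group_hom G H h
    using G H h by (simp add: group_hom_def group_hom_axioms_def iso_def)
  have "h ` conj_class G x = (\<lambda>g. h g \<otimes>\<^bsub>H\<^esub> h x \<otimes>\<^bsub>H\<^esub> inv\<^bsub>H\<^esub> h g) ` carrier G"
    using x by (auto simp: conj_class_def image_def)
  also have "\<dots> = conj_class H (h x)"
  proof -
    have "carrier H = h ` carrier G" using h by (simp add: iso_def bij_betw_def)
    then show ?thesis unfolding conj_class_def by auto
  qed
  finally show ?thesis .
qed

text \<open>Permits the count to be made in \<open>heis\<close> instead of the presented group:
  taking images under \<open>h\<close> is a bijection between the classes, and injectivity of
  \<open>h\<close> keeps their sizes.\<close>

lemma card_conjugacy_classes_iso:
  assumes G: "group G" and H: "group H" and h: "h \<in> iso G H"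
  shows "card {C \<in> conjugacy_classes G. card C = k} =
    card {C \<in> conjugacy_classes H. card C = k}"
proof (rule bij_betw_same_card)
  have inj: "inj_on h (carrier G)" and surj: "h ` carrier G = carrier H"
    using h by (auto simp: iso_def bij_betw_def)
  have card: "card (h ` C) = card C" if "C \<in> conjugacy_classes G" for C
    using that group.conj_class_subset[OF G] inj_on_subset[OF inj]
    by (auto simp: conjugacy_classes_eq intro: card_image)
  have "(`) h ` conjugacy_classes G = conjugacy_classes H"
    unfolding conjugacy_classes_eq surj[symmetric] image_image
    using image_conj_class_iso[OF G H h] by simp
  moreover have "inj_on ((`) h) (conjugacy_classes G)"
    using group.conj_class_subset[OF G]
    by (intro inj_on_subset[OF inj_on_image_Pow[OF inj]]) (auto simp: conjugacy_classes_eq)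
  ultimately show "bij_betw ((`) h) {C \<in> conjugacy_classes G. card C = k}
      {C \<in> conjugacy_classes H. card C = k}"
    using card unfolding bij_betw_def by (auto intro: inj_on_subset simp flip: \<open>_ = conjugacy_classes H\<close>)
qed


section \<open>Collection in groups\<close>

text \<open>Each slot \<open>s\<close> stands for a one-parameter family \<open>f s\<close>, and
  \<open>a s\<close> is its parameter. The list fixes the order of the factors, since the group need
  not be abelian.\<close>

definition slot_prod :: "('g, 'm) monoid_scheme \<Rightarrow> ('s \<Rightarrow> 'r \<Rightarrow> 'g) \<Rightarrow> 's list \<Rightarrow> ('s \<Rightarrow> 'r) \<Rightarrow> 'g"
  where "slot_prod G f l a = foldr (\<lambda>s p. f s (a s) \<otimes>\<^bsub>G\<^esub> p) l \<one>\<^bsub>G\<^esub>"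

lemma slot_prod_simps [simp]:
  "slot_prod G f [] a = \<one>\<^bsub>G\<^esub>"
  "slot_prod G f (s # l) a = f s (a s) \<otimes>\<^bsub>G\<^esub> slot_prod G f l a"
  by (simp_all add: slot_prod_def)

lemma slot_prod_cong:
  "(\<And>s. s \<in> set l \<Longrightarrow> a s = b s) \<Longrightarrow> slot_prod G f l a = slot_prod G f l b"
  by (induction l) auto

lemma (in group) slot_prod_closed:
  "(\<And>s r. s \<in> set l \<Longrightarrow> r \<in> R \<Longrightarrow> f s r \<in> carrier G) \<Longrightarrow> a \<in> set l \<rightarrow> R \<Longrightarrow>
    slot_prod G f l a \<in> carrier G"
  by (induction l) (auto simp: Pi_iff)

lemma (in group) slot_prod_one:
  "(\<And>s. s \<in> set l \<Longrightarrow> f s (a s) = \<one>) \<Longrightarrow> slot_prod G f l a = \<one>"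
  by (induction l) auto

text \<open>The collection process: \<open>f s r\<close> moves to the right past the factors of
  other slots, each exchange leaving a central element of \<open>C\<close>, until it merges with the
  factor of its own slot. The set \<open>C\<close> is a parameter because the process runs once with
  the trivial set and once with the products of edge generators.\<close>

lemma (in group) slot_prod_collect:
  assumes "distinct l" "s \<in> set l" "r \<in> R" "a \<in> set l \<rightarrow> R"
    and f: "\<And>s r. s \<in> set l \<Longrightarrow> r \<in> R \<Longrightarrow> f s r \<in> carrier G"
    and pl: "\<And>s r r'. s \<in> set l \<Longrightarrow> r \<in> R \<Longrightarrow> r' \<in> R \<Longrightarrow> f s r \<otimes> f s r' = f s (pl r r')"
    and pl_closed: "\<And>r r'. r \<in> R \<Longrightarrow> r' \<in> R \<Longrightarrow> pl r r' \<in> R"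
    and C: "\<one> \<in> C" "\<And>c d. c \<in> C \<Longrightarrow> d \<in> C \<Longrightarrow> c \<otimes> d \<in> C" "C \<subseteq> carrier G"
    and central: "\<And>c g. c \<in> C \<Longrightarrow> g \<in> carrier G \<Longrightarrow> c \<otimes> g = g \<otimes> c"
    and comm: "\<And>s t r r'. s \<in> set l \<Longrightarrow> t \<in> set l \<Longrightarrow> s \<noteq> t \<Longrightarrow> r \<in> R \<Longrightarrow> r' \<in> R \<Longrightarrow>
      \<exists>c\<in>C. f s r \<otimes> f t r' = f t r' \<otimes> f s r \<otimes> c"
  shows "\<exists>c\<in>C. f s r \<otimes> slot_prod G f l a = slot_prod G f l (a(s := pl r (a s))) \<otimes> c"
  using assms(1,2,4) f pl comm
proof (induction l)
  case (Cons t l)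
  let ?p = "slot_prod G f l a"
  have a: "a t \<in> R" "a \<in> set l \<rightarrow> R" using Cons.prems(3) by auto
  have fc: "\<And>s r. s \<in> set l \<Longrightarrow> r \<in> R \<Longrightarrow> f s r \<in> carrier G" using Cons.prems(4) by auto
  have p: "?p \<in> carrier G" using slot_prod_closed[OF fc a(2)] by auto
  have s: "f s r \<in> carrier G" and t: "f t (a t) \<in> carrier G"
    using Cons.prems(2,4) a \<open>r \<in> R\<close> by auto
  show ?case
  proof (cases "s = t")
    case True
    then have "f s r \<otimes> slot_prod G f (t # l) a = f t (pl r (a t)) \<otimes> ?p"
      using Cons.prems(5)[of t r "a t"] a \<open>r \<in> R\<close> s t p by (simp flip: m_assoc)
    also have "f t (pl r (a t)) = f t r \<otimes> f t (a t)"
      using Cons.prems(5)[of t r "a t"] a \<open>r \<in> R\<close> by simp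
    finally have "f s r \<otimes> slot_prod G f (t # l) a = f t r \<otimes> f t (a t) \<otimes> ?p \<otimes> \<one>"
      using True s t p by simp
    \<comment> \<open>As the list is distinct, \<open>t\<close> does not occur in \<open>l\<close>,
      so the update at \<open>t\<close> does not change the rest of the product.\<close>
    moreover have "slot_prod G f l (a(t := pl r (a t))) = ?p"
      using Cons.prems(1) by (intro slot_prod_cong) auto
    then have "slot_prod G f (t # l) (a(s := pl r (a s))) = f t (pl r (a t)) \<otimes> ?p"
      using True by (simp only: slot_prod_simps fun_upd_same)
    ultimately have "f s r \<otimes> slot_prod G f (t # l) a =
        slot_prod G f (t # l) (a(s := pl r (a s))) \<otimes> \<one>"
      using True Cons.prems(5)[of t r "a t", OF list.set_intros(1) \<open>r \<in> R\<close> a(1)]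
      by (simp only:)
    then show ?thesis using C(1) by blast
  next
    case False
    then have sl: "s \<in> set l" using Cons.prems(2) by simp
    have "\<exists>c\<in>C. f s r \<otimes> ?p = slot_prod G f l (a(s := pl r (a s))) \<otimes> c"
      using Cons.prems(1) sl a by (intro Cons.IH Cons.prems) auto
    then obtain c where c: "c \<in> C" "f s r \<otimes> ?p = slot_prod G f l (a(s := pl r (a s))) \<otimes> c"
      by blast
    obtain d where d: "d \<in> C" "f s r \<otimes> f t (a t) = f t (a t) \<otimes> f s r \<otimes> d"
      using Cons.prems(6)[of s t r "a t"] sl False a \<open>r \<in> R\<close> by auto
    let ?p' = "slot_prod G f l (a(s := pl r (a s)))"
    have cd: "c \<in> carrier G" "d \<in> carrier G" using c d C by auto
    have p': "?p' \<in> carrier G"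
      using a sl \<open>r \<in> R\<close> pl_closed fc by (intro slot_prod_closed[of _ R]) (auto simp: Pi_iff)
    have "f s r \<otimes> slot_prod G f (t # l) a = f t (a t) \<otimes> f s r \<otimes> d \<otimes> ?p"
      using s t p d by (simp flip: m_assoc)
    \<comment> \<open>The commutator \<open>d\<close> is central and is pushed to the end before the
      induction hypothesis is applied to the tail.\<close>
    also have "\<dots> = f t (a t) \<otimes> (f s r \<otimes> ?p) \<otimes> d"
      using s t p cd central[OF d(1) p] by (simp add: m_assoc)
    also have "\<dots> = f t (a t) \<otimes> (?p' \<otimes> c) \<otimes> d" by (simp add: c)
    also have "\<dots> = slot_prod G f (t # l) (a(s := pl r (a s))) \<otimes> (c \<otimes> d)"
      using False t p' cd by (simp add: m_assoc)
    finally show ?thesis using C c d by blast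
  qed
qed simp


section \<open>The Heisenberg group of an index set of pairs\<close>

text \<open>The graph enters only through \<open>J\<close>, its edges oriented from the smaller
  index to the larger one. This orientation makes some values of the cocycle below vanish.\<close>

locale pair_form = field F for F :: "'r ring" (structure) +
  fixes I :: "nat set" and J :: "(nat \<times> nat) set"
  assumes finite_I: "finite I" and finite_carrier: "finite (carrier F)"
    and J_less: "\<And>j k. (j, k) \<in> J \<Longrightarrow> j \<in> I \<and> k \<in> I \<and> j < k"
begin

text \<open>
  The cocycle \<open>- x\<^sub>k x'\<^sub>j\<close> is chosen so that \<open>x\<^sub>1(a\<^sub>1) \<cdots> x\<^sub>n(a\<^sub>n)\<close>, in increasing order of the indices,
  corresponds to \<open>(a, 0)\<close>.
\<close>

definition heis :: "((nat \<Rightarrow> 'r) \<times> (nat \<times> nat \<Rightarrow> 'r)) monoid"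
  where "heis =
    \<lparr> carrier = (I \<rightarrow>\<^sub>E carrier F) \<times> (J \<rightarrow>\<^sub>E carrier F),
      monoid.mult = (\<lambda>p p'. (\<lambda>i\<in>I. fst p i \<oplus> fst p' i,
        \<lambda>e\<in>J. snd p e \<oplus> snd p' e \<ominus> fst p (snd e) \<otimes> fst p' (fst e))),
      one = (\<lambda>i\<in>I. \<zero>, \<lambda>e\<in>J. \<zero>) \<rparr>"

section \<open>The group structure on pairs of vectors\<close>

lemma J_subset: "J \<subseteq> I \<times> I"
  using J_less by auto

lemma finite_J: "finite J"
  using J_subset finite_I finite_subset by blast

lemma carrier_heis: "carrier heis = (I \<rightarrow>\<^sub>E carrier F) \<times> (J \<rightarrow>\<^sub>E carrier F)"
  by (simp add: heis_def)

lemma mult_heis: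
  "(x, z) \<otimes>\<^bsub>heis\<^esub> (x', z') =
    (\<lambda>i\<in>I. x i \<oplus> x' i, \<lambda>e\<in>J. z e \<oplus> z' e \<ominus> x (snd e) \<otimes> x' (fst e))"
  by (simp add: heis_def)

lemma one_heis: "\<one>\<^bsub>heis\<^esub> = (\<lambda>i\<in>I. \<zero>, \<lambda>e\<in>J. \<zero>)"
  by (simp add: heis_def)

lemma J_mem: "e \<in> J \<Longrightarrow> fst e \<in> I" "e \<in> J \<Longrightarrow> snd e \<in> I"
  using J_subset by auto

text \<open>Associativity is the bilinearity of the cocycle. The left inverse of
  \<open>(x, z)\<close> has first part \<open>-x\<close>; its second part
  \<open>-z - x_k x_j\<close> absorbs the value \<open>x_k x_j\<close> that the cocycle contributes
  to the product.\<close>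

lemma group_heis: "group heis"
proof (rule groupI)
  show "\<one>\<^bsub>heis\<^esub> \<in> carrier heis" by (auto simp: carrier_heis one_heis)
next
  fix p q assume "p \<in> carrier heis" "q \<in> carrier heis"
  then show "p \<otimes>\<^bsub>heis\<^esub> q \<in> carrier heis"
    using J_mem by (cases p; cases q) (auto simp: carrier_heis mult_heis PiE_def Pi_iff)
next
  fix p q r assume "p \<in> carrier heis" "q \<in> carrier heis" "r \<in> carrier heis"
  then obtain x z x' z' x'' z'' where pqr: "p = (x, z)" "q = (x', z')" "r = (x'', z'')"
    and x: "x \<in> I \<rightarrow>\<^sub>E carrier F" "x' \<in> I \<rightarrow>\<^sub>E carrier F" "x'' \<in> I \<rightarrow>\<^sub>E carrier F"
    and z: "z \<in> J \<rightarrow>\<^sub>E carrier F" "z' \<in> J \<rightarrow>\<^sub>E carrier F" "z'' \<in> J \<rightarrow>\<^sub>E carrier F"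
    by (auto simp: carrier_heis)
  have xc: "x i \<in> carrier F" "x' i \<in> carrier F" "x'' i \<in> carrier F" if "i \<in> I" for i
    using that x by auto
  have zc: "z e \<in> carrier F" "z' e \<in> carrier F" "z'' e \<in> carrier F" if "e \<in> J" for e
    using that z by auto
  have "(z e \<oplus> z' e \<ominus> x (snd e) \<otimes> x' (fst e)) \<oplus> z'' e \<ominus> (x (snd e) \<oplus> x' (snd e)) \<otimes> x'' (fst e) =
      z e \<oplus> (z' e \<oplus> z'' e \<ominus> x' (snd e) \<otimes> x'' (fst e)) \<ominus> x (snd e) \<otimes> (x' (fst e) \<oplus> x'' (fst e))"
    if "e \<in> J" for e
    using zc[OF that] xc[OF J_mem(1)[OF that]] xc[OF J_mem(2)[OF that]] by algebra
  then show "p \<otimes>\<^bsub>heis\<^esub> q \<otimes>\<^bsub>heis\<^esub> r = p \<otimes>\<^bsub>heis\<^esub> (q \<otimes>\<^bsub>heis\<^esub> r)"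
    using J_mem xc by (simp add: pqr mult_heis a_assoc cong: restrict_cong)
next
  fix p assume "p \<in> carrier heis"
  then show "\<one>\<^bsub>heis\<^esub> \<otimes>\<^bsub>heis\<^esub> p = p"
    using J_mem
    by (cases p) (auto simp: carrier_heis mult_heis one_heis PiE_def Pi_iff extensional_def
      a_minus_def fun_eq_iff)
next
  fix p assume "p \<in> carrier heis"
  then obtain x z where p: "p = (x, z)" "x \<in> I \<rightarrow>\<^sub>E carrier F" "z \<in> J \<rightarrow>\<^sub>E carrier F"
    by (auto simp: carrier_heis)
  let ?q = "(\<lambda>i\<in>I. \<ominus> x i, \<lambda>e\<in>J. \<ominus> z e \<ominus> x (snd e) \<otimes> x (fst e))"
  have "?q \<in> carrier heis"
    using p J_mem by (auto simp: carrier_heis PiE_def Pi_iff)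
  moreover have "\<ominus> z e \<ominus> x (snd e) \<otimes> x (fst e) \<oplus> z e \<ominus> (\<ominus> x (snd e)) \<otimes> x (fst e) = \<zero>"
    if "e \<in> J" for e
  proof -
    have "x (fst e) \<in> carrier F" "x (snd e) \<in> carrier F" "z e \<in> carrier F"
      using that p J_mem[OF that] by auto
    then show ?thesis by algebra
  qed
  then have "?q \<otimes>\<^bsub>heis\<^esub> p = \<one>\<^bsub>heis\<^esub>"
    using p J_mem by (auto simp: mult_heis one_heis PiE_def Pi_iff l_neg intro!: restrict_ext)
  ultimately show "\<exists>q\<in>carrier heis. q \<otimes>\<^bsub>heis\<^esub> p = \<one>\<^bsub>heis\<^esub>" by blast
qed

section \<open>Centralisers and class sizes\<close>

lemma finite_heis: "finite (carrier heis)"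
  by (simp add: carrier_heis finite_PiE finite_I finite_J finite_carrier)

lemma order_heis: "Coset.order heis = card (carrier F) ^ (card I + card J)"
  by (simp add: Coset.order_def carrier_heis card_cartesian_product card_funcsetE
      finite_I finite_J power_add)

lemma one_less_card: "1 < card (carrier F)"
proof -
  have "card {\<zero>, \<one>} \<le> card (carrier F)" by (intro card_mono finite_carrier) auto
  then show ?thesis by simp
qed

lemma card_power_neq_0: "card (carrier F) ^ k \<noteq> 0"
proof (rule power_not_zero)
  show "card (carrier F) \<noteq> 0" using one_less_card by linarith
qed

text \<open>The two products agree up to the cocycle terms \<open>-y_k x_j\<close> and
  \<open>-x_k y_j\<close>, so the second components \<open>z\<close> and \<open>w\<close>
  cancel.\<close>

lemma commute_heis_iff:
  assumes "x \<in> I \<rightarrow>\<^sub>E carrier F" "y \<in> I \<rightarrow>\<^sub>E carrier F" "z \<in> J \<rightarrow>\<^sub>E carrier F" "w \<in> J \<rightarrow>\<^sub>E carrier F"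
  shows "(y, w) \<otimes>\<^bsub>heis\<^esub> (x, z) = (x, z) \<otimes>\<^bsub>heis\<^esub> (y, w) \<longleftrightarrow>
    (\<forall>(j, k)\<in>J. x j \<otimes> y k = x k \<otimes> y j)"
proof -
  have "w e \<oplus> z e \<ominus> y (snd e) \<otimes> x (fst e) = z e \<oplus> w e \<ominus> x (snd e) \<otimes> y (fst e) \<longleftrightarrow>
    x (fst e) \<otimes> y (snd e) = x (snd e) \<otimes> y (fst e)" if "e \<in> J" for e
  proof -
    have c: "x (fst e) \<in> carrier F" "x (snd e) \<in> carrier F" "y (fst e) \<in> carrier F"
      "y (snd e) \<in> carrier F" "z e \<in> carrier F" "w e \<in> carrier F"
      using assms that J_mem by (auto simp: PiE_def Pi_iff)
    have "w e \<oplus> z e \<ominus> y (snd e) \<otimes> x (fst e) = (z e \<oplus> w e) \<oplus> \<ominus> (x (fst e) \<otimes> y (snd e))"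
      using c by algebra
    moreover have "z e \<oplus> w e \<ominus> x (snd e) \<otimes> y (fst e) = (z e \<oplus> w e) \<oplus> \<ominus> (x (snd e) \<otimes> y (fst e))"
      using c by algebra
    moreover have "t \<oplus> \<ominus> a = t \<oplus> \<ominus> b \<longleftrightarrow> a = b"
      if "a \<in> carrier F" "b \<in> carrier F" "t \<in> carrier F" for a b t
    proof
      assume eq: "t \<oplus> \<ominus> a = t \<oplus> \<ominus> b"
      have "a = t \<ominus> (t \<oplus> \<ominus> a)" using that by algebra
      also have "\<dots> = b" unfolding eq using that by algebra
      finally show "a = b" .
    qed simp
    ultimately show ?thesis using c by simp
  qed
  moreover have "(\<lambda>i\<in>I. y i \<oplus> x i) = (\<lambda>i\<in>I. x i \<oplus> y i)"
    using assms by (intro restrict_ext) (auto simp: a_comm PiE_def Pi_iff)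
  ultimately show ?thesis
    by (auto simp: mult_heis restrict_def fun_eq_iff split_beta)
qed

text \<open>The kernel of the linear map \<open>y\<close> to \<open>[x, y]\<close> from F^I to F^J.
  The centraliser of \<open>(x, z)\<close> is this kernel times all of F^J.\<close>

definition ann :: "(nat \<Rightarrow> 'r) \<Rightarrow> (nat \<Rightarrow> 'r) set"
  where "ann x = {y \<in> I \<rightarrow>\<^sub>E carrier F. \<forall>(j, k)\<in>J. x j \<otimes> y k = x k \<otimes> y j}"

text \<open>In the orbit-stabiliser formula the group order and the centraliser share the factor
  \<open>|F|^|J|\<close>, which cancels.\<close>

lemma card_conj_class_heis:
  assumes "x \<in> I \<rightarrow>\<^sub>E carrier F" "z \<in> J \<rightarrow>\<^sub>E carrier F"
  shows "card (conj_class heis (x, z)) * card (ann x) = card (carrier F) ^ card I"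
proof -
  have "{p \<in> carrier heis. p \<otimes>\<^bsub>heis\<^esub> (x, z) = (x, z) \<otimes>\<^bsub>heis\<^esub> p} = ann x \<times> (J \<rightarrow>\<^sub>E carrier F)"
    using assms commute_heis_iff by (auto simp: carrier_heis ann_def)
  then have eq: "card (conj_class heis (x, z)) * card (ann x) * card (carrier F) ^ card J
      = card (carrier F) ^ card I * card (carrier F) ^ card J"
    using group.card_conj_class_mult_centralizer[OF group_heis, of "(x, z)"] assms
    by (simp only: order_heis card_cartesian_product card_funcsetE finite_J power_add mult.assoc
        carrier_heis mem_Sigma_iff simp_thms if_True)
  show ?thesis by (rule mult_right_cancel[THEN iffD1, OF card_power_neq_0 eq])
qed

text \<open>First components simply add, so conjugation preserves them and a class lies in a single
  fibre over \<open>x\<close>. The bound settles the case of exponents \<open>i\<close> larger than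
  \<open>|J|\<close>.\<close>

lemma card_conj_class_heis_le:
  assumes "p \<in> carrier heis"
  shows "card (conj_class heis p) \<le> card (carrier F) ^ card J"
proof -
  interpret H: group heis by (rule group_heis)
  obtain x z where p: "p = (x, z)" "x \<in> I \<rightarrow>\<^sub>E carrier F" "z \<in> J \<rightarrow>\<^sub>E carrier F"
    using assms by (auto simp: carrier_heis)
  have "conj_class heis p \<subseteq> {x} \<times> (J \<rightarrow>\<^sub>E carrier F)"
  proof
    fix p' assume p': "p' \<in> conj_class heis p"
    then obtain g where g: "g \<in> carrier heis" "p' = g \<otimes>\<^bsub>heis\<^esub> p \<otimes>\<^bsub>heis\<^esub> inv\<^bsub>heis\<^esub> g"
      by (auto simp: conj_class_def)
    have p'c: "p' \<in> carrier heis" using p' H.conj_class_subset[OF assms] by blast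
    \<comment> \<open>Moving \<open>g\<close> to the other side makes the first components
      comparable without computing an inverse in \<open>heis\<close>.\<close>
    have eq: "p' \<otimes>\<^bsub>heis\<^esub> g = g \<otimes>\<^bsub>heis\<^esub> p" using g assms by (simp add: H.m_assoc)
    obtain x' z' y w where c: "p' = (x', z')" "g = (y, w)" by fastforce
    have "x' i = x i" if "i \<in> I" for i
    proof -
      have "x' i \<oplus> y i = y i \<oplus> x i"
        using arg_cong[OF eq, of "\<lambda>p. fst p i"] that by (simp add: c p mult_heis)
      moreover have "x' i \<in> carrier F" "x i \<in> carrier F" "y i \<in> carrier F"
        using that p'c g p c by (auto simp: carrier_heis)
      ultimately show ?thesis by (metis a_comm add.right_cancel)
    qed
    then have "x' = x" using p'c p c by (intro PiE_ext[of _ I "\<lambda>_. carrier F"]) (auto simp: carrier_heis)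
    then show "p' \<in> {x} \<times> (J \<rightarrow>\<^sub>E carrier F)" using p'c c by (auto simp: carrier_heis)
  qed
  then have "card (conj_class heis p) \<le> card ({x} \<times> (J \<rightarrow>\<^sub>E carrier F))"
    by (intro card_mono) (simp_all add: finite_PiE finite_J finite_carrier)
  then show ?thesis by (simp add: card_cartesian_product card_funcsetE finite_J)
qed

section \<open>Vectors with prescribed support\<close>

definition supp :: "(nat \<Rightarrow> 'r) \<Rightarrow> nat set"
  where "supp x = {i \<in> I. x i \<noteq> \<zero>}"

text \<open>Such a vector has an arbitrary nonzero entry at each index of \<open>S\<close> and zero
  elsewhere.\<close>

lemma card_supp_eq:
  assumes "S \<subseteq> I"
  shows "card {x \<in> I \<rightarrow>\<^sub>E carrier F. supp x = S} = (card (carrier F) - 1) ^ card S"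
proof -
  have "{x \<in> I \<rightarrow>\<^sub>E carrier F. supp x = S} = (\<Pi>\<^sub>E i\<in>I. if i \<in> S then carrier F - {\<zero>} else {\<zero>})"
  proof (intro equalityI subsetI)
    fix x assume x0: "x \<in> (\<Pi>\<^sub>E i\<in>I. if i \<in> S then carrier F - {\<zero>} else {\<zero>})"
    have x: "x i \<in> (if i \<in> S then carrier F - {\<zero>} else {\<zero>})" if "i \<in> I" for i
      by (rule PiE_mem[OF x0 that])
    have ext: "x \<in> extensional I" using x0 by (simp add: PiE_def)
    have "x i \<in> carrier F" "x i \<noteq> \<zero> \<longleftrightarrow> i \<in> S" if "i \<in> I" for i
      using x[OF that] by (auto split: if_splits)
    then show "x \<in> {x \<in> I \<rightarrow>\<^sub>E carrier F. supp x = S}"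
      using assms ext by (auto simp: supp_def PiE_def)
  qed (auto simp: supp_def)
  then have "card {x \<in> I \<rightarrow>\<^sub>E carrier F. supp x = S} =
      (\<Prod>i\<in>I. if i \<in> S then card (carrier F - {\<zero>}) else 1)"
    by (simp add: card_PiE finite_I if_distrib cong: if_cong)
  also have "\<dots> = (\<Prod>i\<in>S. card (carrier F - {\<zero>}))"
    using assms by (simp add: prod.If_cases finite_I Int_absorb1)
  finally show ?thesis using finite_carrier by (simp add: card_Diff_singleton)
qed

end

text \<open>
  A vector \<open>y\<close> annihilated by \<open>x\<close> with support \<open>S\<close> vanishes at the neighbours of \<open>S\<close> outside
  \<open>S\<close>, is arbitrary at the remaining indices outside \<open>S\<close>, and is a multiple of \<open>x\<close> on every
  connected component of \<open>S\<close>.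
\<close>

definition free_indices :: "nat set \<Rightarrow> (nat \<times> nat) set \<Rightarrow> nat set \<Rightarrow> nat set"
  where "free_indices I J S = {i \<in> I. i \<in> S \<or> (\<forall>j\<in>S. (i, j) \<notin> J \<and> (j, i) \<notin> J)}"

text \<open>Connectedness in the induced subgraph on \<open>S\<close>. Since the closure is
  reflexive, each free index outside \<open>S\<close> forms a class by itself, so a single quotient
  covers both kinds of free parameters.\<close>

definition component_rel :: "nat set \<Rightarrow> (nat \<times> nat) set \<Rightarrow> nat set \<Rightarrow> (nat \<times> nat) set"
  where "component_rel I J S =
    ((J \<union> J\<inverse>) \<inter> S \<times> S)\<^sup>* \<inter> free_indices I J S \<times> free_indices I J S"

definition ann_dim :: "nat set \<Rightarrow> (nat \<times> nat) set \<Rightarrow> nat set \<Rightarrow> nat"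
  where "ann_dim I J S = card (free_indices I J S // component_rel I J S)"

lemma equiv_component_rel: "equiv (free_indices I J S) (component_rel I J S)"
proof (rule equivI)
  have "sym ((J \<union> J\<inverse>) \<inter> S \<times> S)" by (auto simp: sym_def)
  then have "sym (((J \<union> J\<inverse>) \<inter> S \<times> S)\<^sup>*)" by (rule sym_rtrancl)
  then show "sym (component_rel I J S)"
    by (auto simp: component_rel_def sym_def)
  show "trans (component_rel I J S)"
    unfolding component_rel_def by (auto intro!: transI)
qed (auto simp: component_rel_def refl_on_def)

section \<open>The dimension of the kernel and the number of classes\<close>

context pair_form
begin

text \<open>A vector in the kernel is given by one scalar per class of \<open>component_rel\<close>,
  namely its ratio to \<open>x\<close> on a component of the support and its own value at a free
  index outside the support. This yields a bijection with the functions on the quotient.\<close>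

lemma card_ann:
  assumes x: "x \<in> I \<rightarrow>\<^sub>E carrier F"
  shows "card (ann x) = card (carrier F) ^ ann_dim I J (supp x)"
proof -
  let ?S = "supp x" and ?U = "free_indices I J (supp x)" and ?R = "component_rel I J (supp x)"
  note eqv = equiv_component_rel[of I J ?S]
  \<comment> \<open>The reference vector for the ratios: \<open>x\<close> on the support, and 1
    elsewhere so that division by \<open>c i\<close> is always possible.\<close>
  define c where "c i = (if i \<in> ?S then x i else \<one>)" for i
  define y where "y f = (\<lambda>i\<in>I. if i \<in> ?U then c i \<otimes> f (?R `` {i}) else \<zero>)" for f
  have UI: "?U \<subseteq> I" by (auto simp: free_indices_def)
  have SU: "?S \<subseteq> ?U" by (auto simp: free_indices_def supp_def)
  have c: "c i \<in> carrier F" "c i \<noteq> \<zero>" if "i \<in> I" for i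
    using that x by (auto simp: c_def supp_def)
  have x0: "x i = \<zero>" if "i \<in> I" "i \<notin> ?S" for i using that by (auto simp: supp_def)
  have xc: "x i \<in> carrier F" if "i \<in> I" for i using that x by auto
  have f: "f (?R `` {i}) \<in> carrier F" if "f \<in> (?U // ?R) \<rightarrow>\<^sub>E carrier F" "i \<in> ?U" for f i
    using that by (auto simp: quotientI)
  have not_U: "i \<notin> ?U" if "(i, j) \<in> J \<or> (j, i) \<in> J" "j \<in> ?S" "i \<notin> ?S" for i j
    using that by (auto simp: free_indices_def)
  have "bij_betw y ((?U // ?R) \<rightarrow>\<^sub>E carrier F) (ann x)"
    unfolding bij_betw_def
  proof (intro conjI equalityI subsetI)
    show "inj_on y ((?U // ?R) \<rightarrow>\<^sub>E carrier F)"
    proof (rule inj_onI)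
      fix f g assume fg: "f \<in> (?U // ?R) \<rightarrow>\<^sub>E carrier F" "g \<in> (?U // ?R) \<rightarrow>\<^sub>E carrier F" "y f = y g"
      show "f = g"
      proof (rule PiE_ext[OF fg(1,2)])
        fix C assume "C \<in> ?U // ?R"
        then obtain i where i: "i \<in> ?U" "C = ?R `` {i}" by (auto elim: quotientE)
        have iI: "i \<in> I" using i UI by blast
        have "c i \<otimes> f C = c i \<otimes> g C"
          using fun_cong[OF fg(3), of i] i UI by (auto simp: y_def)
        then show "f C = g C"
          using c[OF iI] f[OF fg(1) i(1)] f[OF fg(2) i(1)] i m_lcancel by auto
      qed
    qed
  next
    fix w assume "w \<in> y ` ((?U // ?R) \<rightarrow>\<^sub>E carrier F)"
    then obtain g where g: "g \<in> (?U // ?R) \<rightarrow>\<^sub>E carrier F" "w = y g" by blast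
    have "w \<in> I \<rightarrow>\<^sub>E carrier F" using g f c UI by (auto simp: y_def)
    moreover have "x j \<otimes> w k = x k \<otimes> w j" if "(j, k) \<in> J" for j k
    proof -
      have jk: "j \<in> I" "k \<in> I" using that J_less by auto
      have wc: "w j \<in> carrier F" "w k \<in> carrier F" using jk \<open>w \<in> I \<rightarrow>\<^sub>E carrier F\<close> by auto
      consider "j \<in> ?S" "k \<in> ?S" | "j \<in> ?S" "k \<notin> ?S" | "j \<notin> ?S" "k \<in> ?S" | "j \<notin> ?S" "k \<notin> ?S"
        by blast
      then show ?thesis
      proof cases
        \<comment> \<open>The indices are adjacent inside the support, hence in the same class, and
          both sides equal \<open>x_j x_k\<close> times the common scalar.\<close>
        case 1
        then have "(j, k) \<in> ?R" using that SU by (auto simp: component_rel_def)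
        then have "?R `` {j} = ?R `` {k}" using eqv by (rule equiv_class_eq[rotated])
        moreover have "g (?R `` {k}) \<in> carrier F" using f g 1 SU by auto
        ultimately show ?thesis
          using 1 SU jk xc by (auto simp: g(2) y_def c_def m_lcomm subset_iff)
      next
        \<comment> \<open>An index outside the support with a neighbour in it is not free; there
          both \<open>x\<close> and \<open>w\<close> vanish.\<close>
        case 2
        then have "w k = \<zero>" using not_U[of k j] that jk by (simp add: g(2) y_def)
        then show ?thesis using x0[of k] 2 jk wc xc by simp
      next
        case 3
        then have "w j = \<zero>" using not_U[of j k] that jk by (simp add: g(2) y_def)
        then show ?thesis using x0[of j] 3 jk wc xc by simp
      next
        case 4
        then show ?thesis using x0 jk wc by simp
      qed
    qed
    ultimately show "w \<in> ann x" by (auto simp: ann_def)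
  next
    fix w assume "w \<in> ann x"
    then have wI: "w \<in> I \<rightarrow>\<^sub>E carrier F"
      and w: "\<And>j k. (j, k) \<in> J \<Longrightarrow> x j \<otimes> w k = x k \<otimes> w j" by (auto simp: ann_def)
    have wc: "w i \<in> carrier F" if "i \<in> I" for i using that wI by auto
    \<comment> \<open>The inverse map: \<open>u\<close> is the ratio of \<open>w\<close> to
      \<open>c\<close>, to be shown constant on classes.\<close>
    define u where "u i = inv (c i) \<otimes> w i" for i
    have inv_c: "inv (c i) \<in> carrier F" "c i \<otimes> inv (c i) = \<one>" if "i \<in> I" for i
      using c[OF that] by (auto simp: field_Units)
    have u: "u i \<in> carrier F" "c i \<otimes> u i = w i" if "i \<in> I" for i
      using that inv_c[OF that] c[OF that] wc[OF that] by (auto simp: u_def simp flip: m_assoc)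
    \<comment> \<open>Along an edge inside the support, the equation
      \<open>x_j w_k = x_k w_j\<close> can be divided by \<open>x_j x_k\<close>.\<close>
    have u_eq: "u j = u k" if "(j, k) \<in> J" "j \<in> ?S" "k \<in> ?S" for j k
    proof -
      have jk: "j \<in> I" "k \<in> I" using that J_less by auto
      have "c j \<otimes> (c k \<otimes> u k) = c k \<otimes> (c j \<otimes> u j)"
        using w[OF that(1)] that u(2)[OF jk(1)] u(2)[OF jk(2)] by (simp add: c_def)
      also have "\<dots> = c j \<otimes> (c k \<otimes> u j)" using c jk u(1) by (simp add: m_lcomm)
      finally show ?thesis using c jk u m_lcancel by (metis m_closed)
    qed
    have u_rtrancl: "u i = u j" if "(i, j) \<in> ((J \<union> J\<inverse>) \<inter> ?S \<times> ?S)\<^sup>*" for i j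
      using that by induction (auto dest: u_eq)
    \<comment> \<open>The choice of a representative is harmless, because \<open>u\<close> is
      constant along paths in the support.\<close>
    define g where "g = (\<lambda>C\<in>?U // ?R. u (SOME i. i \<in> C))"
    have g: "g (?R `` {i}) = u i" if "i \<in> ?U" for i
    proof -
      have "i \<in> ?R `` {i}" using that eqv by (rule equiv_class_self[rotated])
      then have "(SOME k. k \<in> ?R `` {i}) \<in> ?R `` {i}" by (rule someI)
      then have "u i = u (SOME k. k \<in> ?R `` {i})" using u_rtrancl by (auto simp: component_rel_def)
      then show ?thesis using that by (simp add: g_def quotientI)
    qed
    have "g \<in> (?U // ?R) \<rightarrow>\<^sub>E carrier F"
    proof (rule PiE_I)
      fix C assume "C \<in> ?U // ?R"
      then obtain i where "i \<in> ?U" "C = ?R `` {i}" by (auto elim: quotientE)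
      then show "g C \<in> carrier F" using g u UI by auto
    qed (simp add: g_def)
    moreover have "y g = w"
    proof
      fix i
      consider "i \<notin> I" | "i \<in> ?U" | "i \<in> I" "i \<notin> ?U" by blast
      then show "y g i = w i"
      proof cases
        case 1
        then show ?thesis using wI by (auto simp: y_def)
      next
        case 2
        then show ?thesis using g u UI by (auto simp: y_def)
      next
        case 3
        \<comment> \<open>A non-free index has a neighbour \<open>j\<close> in the support; the
          equation for that edge reads \<open>x_j w_i = 0\<close> with \<open>x_j\<close>
          nonzero.\<close>
        then obtain j where j: "j \<in> ?S" "(i, j) \<in> J \<or> (j, i) \<in> J" "i \<notin> ?S"
          by (auto simp: free_indices_def)
        have jI: "j \<in> I" using j(1) by (auto simp: supp_def)
        have "x i = \<zero>" using x0 3 j by blast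
        then have "x j \<otimes> w i = \<zero>" using j(2) w[of i j] w[of j i] wc[OF jI] by auto
        then have "w i = \<zero>"
          using j(1) integral_iff[OF xc[OF jI] wc[OF 3(1)]] by (simp add: supp_def)
        then show ?thesis using 3 by (simp add: y_def)
      qed
    qed
    ultimately show "w \<in> y ` ((?U // ?R) \<rightarrow>\<^sub>E carrier F)" by blast
  qed
  then have "card (ann x) = card ((?U // ?R) \<rightarrow>\<^sub>E carrier F)" by (simp add: bij_betw_same_card)
  moreover have "finite (?U // ?R)"
    using finite_I UI by (meson finite_quotient finite_subset eqv equiv_type)
  ultimately show ?thesis by (simp add: card_funcsetE ann_dim_def)
qed

text \<open>Both sides are powers of \<open>|F|\<close>, which exceeds 1, so exponents may be
  compared. The additive form avoids truncated subtraction.\<close>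

lemma card_conj_class_heis_eq_iff:
  assumes "x \<in> I \<rightarrow>\<^sub>E carrier F" "z \<in> J \<rightarrow>\<^sub>E carrier F"
  shows "card (conj_class heis (x, z)) = card (carrier F) ^ i \<longleftrightarrow> i + ann_dim I J (supp x) = card I"
proof -
  let ?q = "card (carrier F)"
  have "card (conj_class heis (x, z)) * ?q ^ ann_dim I J (supp x) = ?q ^ card I"
    using card_conj_class_heis[OF assms] card_ann[OF assms(1)] by simp
  then have "card (conj_class heis (x, z)) = ?q ^ i \<longleftrightarrow>
      ?q ^ i * ?q ^ ann_dim I J (supp x) = ?q ^ card I"
    using mult_right_cancel[OF card_power_neq_0] by metis
  also have "\<dots> \<longleftrightarrow> i + ann_dim I J (supp x) = card I"
    by (simp only: power_inject_exp[OF one_less_card] flip: power_add)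
  finally show ?thesis .
qed

text \<open>The size of the class of \<open>(x, z)\<close> depends only on the support of
  \<open>x\<close>. Counting elements by support leaves \<open>z\<close> free, hence the factor
  \<open>|F|^|J|\<close>.\<close>

lemma card_conjugacy_classes_heis_mult:
  "card {C \<in> conjugacy_classes heis. card C = card (carrier F) ^ i} * card (carrier F) ^ i =
    card (carrier F) ^ card J *
    (\<Sum>S | S \<subseteq> I \<and> i + ann_dim I J S = card I. (card (carrier F) - 1) ^ card S)"
proof -
  let ?q = "card (carrier F)" and ?P = "{S. S \<subseteq> I \<and> i + ann_dim I J S = card I}"
  let ?X = "\<lambda>S. {x \<in> I \<rightarrow>\<^sub>E carrier F. supp x = S}"
  have elems: "{p \<in> carrier heis. card (conj_class heis p) = ?q ^ i} = (\<Union>S\<in>?P. ?X S) \<times> (J \<rightarrow>\<^sub>E carrier F)"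
    (is "?L = _")
  proof -
    have "supp x \<subseteq> I" for x by (auto simp: supp_def)
    then have eq: "(x, z) \<in> ?L \<longleftrightarrow> (x, z) \<in> (\<Union>S\<in>?P. ?X S) \<times> (J \<rightarrow>\<^sub>E carrier F)" for x z
      by (cases "x \<in> I \<rightarrow>\<^sub>E carrier F \<and> z \<in> J \<rightarrow>\<^sub>E carrier F")
        (auto simp: carrier_heis card_conj_class_heis_eq_iff)
    show ?thesis
    proof (rule Set.set_eqI)
      show "p \<in> ?L \<longleftrightarrow> p \<in> (\<Union>S\<in>?P. ?X S) \<times> (J \<rightarrow>\<^sub>E carrier F)" for p
        using eq[of "fst p" "snd p"] unfolding prod.collapse .
    qed
  qed
  have "card (\<Union>S\<in>?P. ?X S) = (\<Sum>S\<in>?P. card (?X S))"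
  proof (rule card_UN_disjoint)
    show "\<forall>S\<in>?P. finite (?X S)" using finite_I finite_carrier by (simp add: finite_PiE)
  qed (use finite_I in auto)
  also have "\<dots> = (\<Sum>S\<in>?P. (?q - 1) ^ card S)"
    by (rule sum.cong[OF HOL.refl]) (simp only: card_supp_eq mem_Collect_eq)
  finally have "card ?L = (\<Sum>S\<in>?P. (?q - 1) ^ card S) * ?q ^ card J"
    unfolding elems card_cartesian_product by (simp only: card_funcsetE finite_J)
  then show ?thesis
    unfolding group.card_conjugacy_classes_mult[OF group_heis finite_heis]
    by (rule HOL.trans[OF _ mult.commute])
qed

lemma card_conjugacy_classes_heis:
  "card {C \<in> conjugacy_classes heis. card C = card (carrier F) ^ i} =
    (\<Sum>S | S \<subseteq> I \<and> i + ann_dim I J S = card I.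
      card (carrier F) ^ (card J - i) * (card (carrier F) - 1) ^ card S)"
proof -
  let ?q = "card (carrier F)" and ?P = "{S. S \<subseteq> I \<and> i + ann_dim I J S = card I}"
  let ?N = "card {C \<in> conjugacy_classes heis. card C = ?q ^ i}"
    and ?s = "\<Sum>S\<in>?P. (?q - 1) ^ card S"
  have eq: "?N * ?q ^ i = ?q ^ card J * ?s" by (rule card_conjugacy_classes_heis_mult)
  have "?N = ?q ^ (card J - i) * ?s"
  proof (cases "i \<le> card J")
    case True
    then have "?q ^ card J = ?q ^ (card J - i) * ?q ^ i" by (simp flip: power_add)
    then have "?N * ?q ^ i = ?q ^ (card J - i) * ?s * ?q ^ i"
      unfolding eq by (simp only: mult_ac)
    then show ?thesis by (rule mult_right_cancel[THEN iffD1, OF card_power_neq_0])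
  \<comment> \<open>For \<open>i > |J|\<close> the exponent \<open>card J - i\<close> is truncated
    to 0. This does no harm: no class is that large, which forces the sum over \<open>S\<close> to
    vanish too.\<close>
  next
    case False
    then have "?q ^ card J < ?q ^ i" by (intro power_strict_increasing one_less_card) simp
    then have "{C \<in> conjugacy_classes heis. card C = ?q ^ i} = {}"
      using card_conj_class_heis_le by (fastforce simp: conjugacy_classes_eq)
    then have "?N = 0" by (simp only: card.empty)
    moreover from this have "?q ^ card J * ?s = 0" using eq by (simp only: mult_0)
    then have "?s = 0" using card_power_neq_0 by (simp only: mult_eq_0_iff simp_thms)
    ultimately show ?thesis by (simp only: mult_0_right)
  qed
  then show ?thesis by (simp add: sum_distrib_left)
qed

end


section \<open>Graphical groups are Heisenberg groups\<close>

lemma letter_gwords: "s \<in> S \<Longrightarrow> letter s \<in> gwords S"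
  by (simp add: letter_def gwords_def)

lemma comm_word_gwords: "s \<in> S \<Longrightarrow> t \<in> S \<Longrightarrow> comm_word (letter s) (letter t) \<in> gwords S"
  by (simp add: comm_word_def gwords_append inv_word_gwords letter_gwords)

lemma word_class_carrier: "w \<in> gwords S \<Longrightarrow> word_class S Q w \<in> carrier (presented_group S Q)"
  by (simp add: presented_group_def)

lemma word_class_inv_word:
  assumes "w \<in> gwords S"
  shows "word_class S Q (inv_word w) = inv\<^bsub>presented_group S Q\<^esub> word_class S Q w"
proof -
  interpret group "presented_group S Q" by (rule group_presented_group)
  have "word_class S Q (inv_word w) \<otimes>\<^bsub>presented_group S Q\<^esub> word_class S Q w = word_class S Q []"
    using assms word_eq_inv_word[OF assms]
    by (simp add: presented_mult inv_word_gwords gwords_append word_class_eq_iff)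
  also have "\<dots> = \<one>\<^bsub>presented_group S Q\<^esub>" by (simp add: presented_group_def)
  finally show ?thesis
    using assms by (intro inv_equality[symmetric]) (simp_all add: word_class_carrier inv_word_gwords)
qed

lemma word_class_Cons:
  assumes "s \<in> S" "w \<in> gwords S"
  shows "word_class S Q ((s, b) # w) =
    (if b then word_class S Q (letter s) else inv\<^bsub>presented_group S Q\<^esub> word_class S Q (letter s))
      \<otimes>\<^bsub>presented_group S Q\<^esub> word_class S Q w"
proof -
  have "word_class S Q ((s, b) # w) =
      word_class S Q [(s, b)] \<otimes>\<^bsub>presented_group S Q\<^esub> word_class S Q w"
    using assms by (simp add: presented_mult gwords_def)
  moreover have "[(s, b)] = (if b then letter s else inv_word (letter s))"
    by (simp add: letter_def inv_word_def)
  ultimately show ?thesis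
    using word_class_inv_word[OF letter_gwords[OF assms(1)], of Q] by (cases b) simp_all
qed

text \<open>Evaluation in the presented group itself returns the class of the word, so the defining
  relations become equations between values of \<open>word_val\<close>.\<close>

lemma word_val_word_class:
  assumes "w \<in> gwords S"
  shows "word_val (presented_group S Q) (\<lambda>s. word_class S Q (letter s)) w = word_class S Q w"
  using assms
proof (induction w)
  case Nil
  show ?case by (simp add: presented_group_def)
next
  case (Cons a w)
  then have "w \<in> gwords S" "fst a \<in> S" by (auto simp: gwords_def)
  then show ?case using Cons.IH word_class_Cons[of "fst a" S w Q "snd a"] by simp
qed

lemma presented_group_relation:
  assumes "(u, w) \<in> Q" "u \<in> gwords S" "w \<in> gwords S"
  shows "word_val (presented_group S Q) (\<lambda>s. word_class S Q (letter s)) u =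
    word_val (presented_group S Q) (\<lambda>s. word_class S Q (letter s)) w"
  using assms by (simp add: word_val_word_class word_class_eq_iff word_eq.rel)

text \<open>Induction over a word representing \<open>x\<close>; a first letter may be a generator
  or a formal inverse, whence two steps.\<close>

lemma presented_group_induct [consumes 1, case_names one gen gen_inv]:
  assumes "x \<in> carrier (presented_group S Q)"
    and one: "P \<one>\<^bsub>presented_group S Q\<^esub>"
    and gen: "\<And>s y. s \<in> S \<Longrightarrow> y \<in> carrier (presented_group S Q) \<Longrightarrow> P y \<Longrightarrow>
      P (word_class S Q (letter s) \<otimes>\<^bsub>presented_group S Q\<^esub> y)"
    and gen_inv: "\<And>s y. s \<in> S \<Longrightarrow> y \<in> carrier (presented_group S Q) \<Longrightarrow> P y \<Longrightarrow>
      P (inv\<^bsub>presented_group S Q\<^esub> word_class S Q (letter s) \<otimes>\<^bsub>presented_group S Q\<^esub> y)"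
  shows "P x"
proof -
  obtain w where w: "w \<in> gwords S" "x = word_class S Q w"
    using assms(1) by (auto simp: presented_group_def)
  have "P (word_class S Q w)" using w(1)
  proof (induction w)
    case Nil
    then show ?case using one by (simp add: presented_group_def)
  next
    case (Cons a w)
    then have a: "w \<in> gwords S" "fst a \<in> S" by (auto simp: gwords_def)
    then have "P (word_class S Q ((fst a, snd a) # w))"
      unfolding word_class_Cons[OF a(2,1)]
      using gen[OF a(2) word_class_carrier[OF a(1)] Cons.IH[OF a(1)]]
        gen_inv[OF a(2) word_class_carrier[OF a(1)] Cons.IH[OF a(1)]]
      by (simp split: if_split)
    then show ?case by simp
  qed
  then show ?thesis by (simp add: w)
qed

lemma (in group) word_val_letter: "f s \<in> carrier G \<Longrightarrow> word_val G f (letter s) = f s"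
  by (simp add: letter_def)

lemma (in group) word_val_letter_append:
  "f s \<in> carrier G \<Longrightarrow> f t \<in> carrier G \<Longrightarrow> word_val G f (letter s @ letter t) = f s \<otimes> f t"
  by (simp add: letter_def)

text \<open>Turns a relation \<open>[a, b] = c\<close> into the exchange rule
  \<open>a b = b a c\<close> that collection needs.\<close>

lemma (in group) word_val_comm_word_iff:
  assumes "f s \<in> carrier G" "f t \<in> carrier G" "c \<in> carrier G"
  shows "word_val G f (comm_word (letter s) (letter t)) = c \<longleftrightarrow> f s \<otimes> f t = f t \<otimes> f s \<otimes> c"
proof -
  have "word_val G f (comm_word (letter s) (letter t)) = inv (f s) \<otimes> (inv (f t) \<otimes> (f s \<otimes> f t))"
    using assms by (simp add: comm_word_def letter_def inv_word_def)
  also have "\<dots> = inv (f t \<otimes> f s) \<otimes> (f s \<otimes> f t)"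
    using assms by (simp add: inv_mult_group m_assoc)
  also have "\<dots> = c \<longleftrightarrow> f s \<otimes> f t = f t \<otimes> f s \<otimes> c"
    using assms by (metis inv_solve_left m_closed)
  finally show ?thesis .
qed

section \<open>Graphical groups over a finite field\<close>

definition vert_indices :: "'v pair_pre_digraph \<Rightarrow> nat set"
  where "vert_indices \<Gamma> = {1..card (pverts \<Gamma>)}"

locale graphical = field F for F :: "'r ring" (structure) +
  fixes \<Gamma> :: "'v pair_pre_digraph" and v :: "nat \<Rightarrow> 'v"
  assumes finite_field: "finite (carrier F)" and sym_parcs: "sym (parcs \<Gamma>)"
begin

abbreviation I :: "nat set" where "I \<equiv> vert_indices \<Gamma>"
abbreviation J :: "(nat \<times> nat) set" where "J \<equiv> edge_indices \<Gamma> v"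
abbreviation G :: "'r graph_gen gword set monoid" where "G \<equiv> graphical_group \<Gamma> v F"

sublocale pair_form F I J
  by unfold_locales (auto simp: finite_field edge_indices_def vert_indices_def)

sublocale G: group G
  unfolding graphical_group_def by (rule group_presented_group)

sublocale H: group heis
  by (rule group_heis)

text \<open>The prescribed images of the generators under the isomorphism to be constructed:
  multiples of unit vectors.\<close>

primrec heis_gen :: "'r graph_gen \<Rightarrow> (nat \<Rightarrow> 'r) \<times> (nat \<times> nat \<Rightarrow> 'r)" where
  "heis_gen (Vert i r) = (\<lambda>l\<in>I. if l = i then r else \<zero>, \<lambda>e\<in>J. \<zero>)"
| "heis_gen (Edge j k r) = (\<lambda>l\<in>I. \<zero>, \<lambda>e\<in>J. if e = (j, k) then r else \<zero>)"

declare heis_gen.simps [simp del]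

section \<open>The defining relations in the Heisenberg group\<close>

lemma vert_gens: "Vert i r \<in> graph_gens \<Gamma> v F \<longleftrightarrow> i \<in> I \<and> r \<in> carrier F"
  by (auto simp: graph_gens_def vert_indices_def)

lemma edge_gens: "Edge j k r \<in> graph_gens \<Gamma> v F \<longleftrightarrow> (j, k) \<in> J \<and> r \<in> carrier F"
  by (auto simp: graph_gens_def vert_indices_def)

lemma heis_gen_closed: "s \<in> graph_gens \<Gamma> v F \<Longrightarrow> heis_gen s \<in> carrier heis"
  by (cases s) (auto simp: vert_gens edge_gens carrier_heis heis_gen.simps)

text \<open>The cocycle could contribute only at the pair \<open>(i, i)\<close>, which is not in
  \<open>J\<close>.\<close>

lemma heis_Vert_add:
  assumes "r \<in> carrier F" "r' \<in> carrier F"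
  shows "heis_gen (Vert i r) \<otimes>\<^bsub>heis\<^esub> heis_gen (Vert i r') = heis_gen (Vert i (r \<oplus> r'))"
proof -
  have "(i, i) \<notin> J" using J_less by blast
  then show ?thesis
    using assms J_mem by (auto simp: mult_heis heis_gen.simps a_minus_def intro!: restrict_ext)
qed

lemma heis_Edge_add:
  assumes "r \<in> carrier F" "r' \<in> carrier F"
  shows "heis_gen (Edge j k r) \<otimes>\<^bsub>heis\<^esub> heis_gen (Edge j k r') = heis_gen (Edge j k (r \<oplus> r'))"
  using assms J_mem by (auto simp: mult_heis heis_gen.simps a_minus_def intro!: restrict_ext)

text \<open>In increasing order the cocycle contributes nothing, since \<open>(k, j)\<close> is not
  in \<open>J\<close>. In decreasing order it contributes \<open>-r' r\<close> at
  \<open>(j, k)\<close>, which the edge generator cancels.\<close>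

lemma heis_Vert_comm:
  assumes "(j, k) \<in> J" "r \<in> carrier F" "r' \<in> carrier F"
  shows "heis_gen (Vert j r) \<otimes>\<^bsub>heis\<^esub> heis_gen (Vert k r') =
    heis_gen (Vert k r') \<otimes>\<^bsub>heis\<^esub> heis_gen (Vert j r) \<otimes>\<^bsub>heis\<^esub> heis_gen (Edge j k (r \<otimes> r'))"
proof -
  have "j < k" using assms J_less by blast
  have zero: "\<ominus> (r' \<otimes> r) \<oplus> r \<otimes> r' = \<zero>" using assms by algebra
  let ?d = "\<lambda>i s l. if l = i then s else \<zero>"
  have "\<zero> \<oplus> \<zero> \<ominus> ?d j r b \<otimes> ?d k r' a =
      (\<zero> \<oplus> \<zero> \<ominus> ?d k r' b \<otimes> ?d j r a) \<oplus> ?d (j, k) (r \<otimes> r') (a, b) \<ominus> (?d k r' b \<oplus> ?d j r b) \<otimes> \<zero>"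
    if "(a, b) \<in> J" for a b
  proof -
    have "a < b" using that J_less by blast
    then have "\<not> (b = j \<and> a = k)" using \<open>j < k\<close> by auto
    then have "\<zero> \<oplus> \<zero> \<ominus> ?d j r b \<otimes> ?d k r' a = \<zero>" using assms by (auto simp: a_minus_def)
    moreover have "(\<zero> \<oplus> \<zero> \<ominus> ?d k r' b \<otimes> ?d j r a) \<oplus> ?d (j, k) (r \<otimes> r') (a, b) \<ominus>
        (?d k r' b \<oplus> ?d j r b) \<otimes> \<zero> = \<zero>"
      using assms zero by (cases "a = j"; cases "b = k") (simp_all add: a_minus_def)
    ultimately show ?thesis by (rule HOL.trans[OF _ HOL.sym])
  qed
  moreover have "?d j r l \<oplus> ?d k r' l = ?d k r' l \<oplus> ?d j r l \<oplus> \<zero>" for l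
    using assms by (simp add: a_comm)
  ultimately show ?thesis
    using J_less unfolding heis_gen.simps mult_heis prod.inject
    by (intro conjI restrict_ext) (auto simp: J_mem)
qed

lemma heis_Vert_commute:
  assumes "(i, i') \<notin> J" "(i', i) \<notin> J" "r \<in> carrier F" "r' \<in> carrier F"
  shows "heis_gen (Vert i r) \<otimes>\<^bsub>heis\<^esub> heis_gen (Vert i' r') =
    heis_gen (Vert i' r') \<otimes>\<^bsub>heis\<^esub> heis_gen (Vert i r)"
  unfolding heis_gen.simps using assms J_less
  by (subst commute_heis_iff) auto

text \<open>The first component of an edge generator is zero, so the commutator form vanishes
  against every element.\<close>

lemma heis_Edge_commute:
  assumes "p \<in> carrier heis" "r \<in> carrier F"
  shows "p \<otimes>\<^bsub>heis\<^esub> heis_gen (Edge j k r) = heis_gen (Edge j k r) \<otimes>\<^bsub>heis\<^esub> p"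
proof -
  obtain x z where p: "p = (x, z)" "x \<in> I \<rightarrow>\<^sub>E carrier F" "z \<in> J \<rightarrow>\<^sub>E carrier F"
    using assms(1) by (auto simp: carrier_heis)
  have "x i \<in> carrier F" if "i \<in> I" for i using that p by auto
  then show ?thesis
    unfolding p heis_gen.simps using assms(2) p J_less by (subst commute_heis_iff) auto
qed

lemma not_arc_not_J:
  assumes "(v i, v i') \<notin> parcs \<Gamma>"
  shows "(i, i') \<notin> J" "(i', i) \<notin> J"
  using assms sym_parcs by (auto simp: edge_indices_def sym_def)

text \<open>\<open>J\<close> holds increasing pairs only; an arc running from the larger index to
  the smaller is caught through symmetry of adjacency.\<close>

lemma arc_J:
  assumes "i \<in> I" "i' \<in> I" "i \<noteq> i'" "(v i, v i') \<in> parcs \<Gamma>"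
  shows "(i, i') \<in> J \<or> (i', i) \<in> J"
  using assms sym_parcs by (auto simp: edge_indices_def vert_indices_def sym_def)

text \<open>This is the hypothesis of the universal property, checked for the six families of
  relations in turn.\<close>

lemma heis_gen_relations:
  assumes "(u, w) \<in> graph_rels \<Gamma> v F"
  shows "word_val heis heis_gen u = word_val heis heis_gen w"
proof -
  have V: "heis_gen (Vert i r) \<in> carrier heis" if "i \<in> I" "r \<in> carrier F" for i r
    by (rule heis_gen_closed) (simp add: vert_gens that)
  have E: "heis_gen (Edge j k r) \<in> carrier heis" if "(j, k) \<in> J" "r \<in> carrier F" for j k r
    by (rule heis_gen_closed) (simp add: edge_gens that)
  from assms show ?thesis
    unfolding graph_rels_def Let_def vert_indices_def[symmetric]
  proof (elim UnE CollectE exE conjE Pair_inject)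
    fix i r r'
    assume "u = letter (Vert i r) @ letter (Vert i r')" "w = letter (Vert i (r \<oplus> r'))"
      "i \<in> I" "r \<in> carrier F" "r' \<in> carrier F"
    then show ?thesis
      using V by (simp add: H.word_val_letter_append H.word_val_letter heis_Vert_add)
  next
    fix j k r r'
    assume "u = letter (Edge j k r) @ letter (Edge j k r')" "w = letter (Edge j k (r \<oplus> r'))"
      "(j, k) \<in> J" "r \<in> carrier F" "r' \<in> carrier F"
    then show ?thesis
      using E by (simp add: H.word_val_letter_append H.word_val_letter heis_Edge_add)
  next
    fix j k r r'
    assume *: "u = comm_word (letter (Vert j r)) (letter (Vert k r'))" "w = letter (Edge j k (r \<otimes> r'))"
      "(j, k) \<in> J" "r \<in> carrier F" "r' \<in> carrier F"
    then have "j \<in> I" "k \<in> I" using J_less by blast+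
    then show ?thesis
      using * V[of j r] V[of k r'] E[of j k "r \<otimes> r'"] heis_Vert_comm[OF *(3-5)]
        H.word_val_comm_word_iff[of heis_gen "Vert j r" "Vert k r'" "heis_gen (Edge j k (r \<otimes> r'))"]
      by (simp add: H.word_val_letter)
  next
    fix i i' r r'
    assume *: "u = comm_word (letter (Vert i r)) (letter (Vert i' r'))" "w = []"
      "i \<in> I" "i' \<in> I" "(v i, v i') \<notin> parcs \<Gamma>" "r \<in> carrier F" "r' \<in> carrier F"
    then show ?thesis
      using V[of i r] V[of i' r'] heis_Vert_commute[OF not_arc_not_J[OF *(5)] *(6,7)]
      by (simp add: H.word_val_comm_word_iff)
  next
    fix i j k r r'
    assume "u = comm_word (letter (Vert i r)) (letter (Edge j k r'))" "w = []"
      "i \<in> I" "(j, k) \<in> J" "r \<in> carrier F" "r' \<in> carrier F"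
    then show ?thesis
      using V[of i r] E[of j k r'] heis_Edge_commute[of "heis_gen (Vert i r)" r' j k]
      by (simp add: H.word_val_comm_word_iff)
  next
    fix j' k' j k r r'
    assume "u = comm_word (letter (Edge j' k' r)) (letter (Edge j k r'))" "w = []"
      "(j', k') \<in> J" "(j, k) \<in> J" "r \<in> carrier F" "r' \<in> carrier F"
    then show ?thesis
      using E[of j' k' r] E[of j k r'] heis_Edge_commute[of "heis_gen (Edge j' k' r)" r' j k]
      by (simp add: H.word_val_comm_word_iff)
  qed
qed

section \<open>The defining relations in the graphical group\<close>

definition gen :: "'r graph_gen \<Rightarrow> 'r graph_gen gword set"
  where "gen s = word_class (graph_gens \<Gamma> v F) (graph_rels \<Gamma> v F) (letter s)"

lemma gen_closed: "s \<in> graph_gens \<Gamma> v F \<Longrightarrow> gen s \<in> carrier G"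
  by (simp add: gen_def graphical_group_def word_class_carrier letter_gwords)

lemma gen_relation:
  assumes "(u, w) \<in> graph_rels \<Gamma> v F" "u \<in> gwords (graph_gens \<Gamma> v F)" "w \<in> gwords (graph_gens \<Gamma> v F)"
  shows "word_val G gen u = word_val G gen w"
  using presented_group_relation[OF assms] by (simp add: gen_def[abs_def] graphical_group_def)

lemma Vert_add:
  assumes "i \<in> I" "r \<in> carrier F" "r' \<in> carrier F"
  shows "gen (Vert i r) \<otimes>\<^bsub>G\<^esub> gen (Vert i r') = gen (Vert i (r \<oplus> r'))"
proof -
  have "(letter (Vert i r) @ letter (Vert i r'), letter (Vert i (r \<oplus> r'))) \<in> graph_rels \<Gamma> v F"
    unfolding graph_rels_def Let_def vert_indices_def[symmetric]
    \<comment> \<open>The union of the six families nests to the left, so five uses of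
      \<open>UnI1\<close> reach the first family; the later lemmas select theirs in the same
      way.\<close>
    by (rule UnI1, rule UnI1, rule UnI1, rule UnI1, rule UnI1) (use assms in blast)
  then have "word_val G gen (letter (Vert i r) @ letter (Vert i r'))
      = word_val G gen (letter (Vert i (r \<oplus> r')))"
    using assms by (intro gen_relation) (simp_all add: gwords_append letter_gwords vert_gens)
  then show ?thesis
    using assms by (simp add: G.word_val_letter_append G.word_val_letter gen_closed vert_gens)
qed

lemma Edge_add:
  assumes "(j, k) \<in> J" "r \<in> carrier F" "r' \<in> carrier F"
  shows "gen (Edge j k r) \<otimes>\<^bsub>G\<^esub> gen (Edge j k r') = gen (Edge j k (r \<oplus> r'))"
proof -
  have "(letter (Edge j k r) @ letter (Edge j k r'), letter (Edge j k (r \<oplus> r'))) \<in> graph_rels \<Gamma> v F"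
    unfolding graph_rels_def Let_def vert_indices_def[symmetric]
    by (rule UnI1, rule UnI1, rule UnI1, rule UnI1, rule UnI2) (use assms in blast)
  then have "word_val G gen (letter (Edge j k r) @ letter (Edge j k r'))
      = word_val G gen (letter (Edge j k (r \<oplus> r')))"
    using assms by (intro gen_relation) (simp_all add: gwords_append letter_gwords edge_gens)
  then show ?thesis
    using assms by (simp add: G.word_val_letter_append G.word_val_letter gen_closed edge_gens)
qed

lemma Vert_comm:
  assumes "(j, k) \<in> J" "r \<in> carrier F" "r' \<in> carrier F"
  shows "gen (Vert j r) \<otimes>\<^bsub>G\<^esub> gen (Vert k r') =
    gen (Vert k r') \<otimes>\<^bsub>G\<^esub> gen (Vert j r) \<otimes>\<^bsub>G\<^esub> gen (Edge j k (r \<otimes> r'))"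
proof -
  have jk: "j \<in> I" "k \<in> I" using assms J_less by blast+
  have "(comm_word (letter (Vert j r)) (letter (Vert k r')), letter (Edge j k (r \<otimes> r')))
      \<in> graph_rels \<Gamma> v F"
    unfolding graph_rels_def Let_def vert_indices_def[symmetric]
    by (rule UnI1, rule UnI1, rule UnI1, rule UnI2) (use assms in blast)
  then have "word_val G gen (comm_word (letter (Vert j r)) (letter (Vert k r')))
      = word_val G gen (letter (Edge j k (r \<otimes> r')))"
    using assms jk
    by (intro gen_relation) (simp_all add: comm_word_gwords letter_gwords edge_gens vert_gens)
  then show ?thesis
    using assms jk
    by (simp add: G.word_val_comm_word_iff G.word_val_letter gen_closed edge_gens vert_gens)
qed

lemma gen_commute:
  assumes "(comm_word (letter s) (letter t), []) \<in> graph_rels \<Gamma> v F"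
    and "s \<in> graph_gens \<Gamma> v F" "t \<in> graph_gens \<Gamma> v F"
  shows "gen s \<otimes>\<^bsub>G\<^esub> gen t = gen t \<otimes>\<^bsub>G\<^esub> gen s"
proof -
  have "word_val G gen (comm_word (letter s) (letter t)) = word_val G gen []"
    using assms by (intro gen_relation comm_word_gwords) (simp_all add: gwords_def)
  then show ?thesis using assms by (simp add: G.word_val_comm_word_iff gen_closed)
qed

lemma Vert_commute:
  assumes "i \<in> I" "i' \<in> I" "(v i, v i') \<notin> parcs \<Gamma>" "r \<in> carrier F" "r' \<in> carrier F"
  shows "gen (Vert i r) \<otimes>\<^bsub>G\<^esub> gen (Vert i' r') = gen (Vert i' r') \<otimes>\<^bsub>G\<^esub> gen (Vert i r)"
proof (rule gen_commute)
  show "(comm_word (letter (Vert i r)) (letter (Vert i' r')), []) \<in> graph_rels \<Gamma> v F"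
    unfolding graph_rels_def Let_def vert_indices_def[symmetric]
    by (rule UnI1, rule UnI1, rule UnI2) (use assms in blast)
qed (use assms in \<open>simp_all add: vert_gens\<close>)

lemma Edge_commute_gen:
  assumes "(j, k) \<in> J" "r \<in> carrier F" "s \<in> graph_gens \<Gamma> v F"
  shows "gen s \<otimes>\<^bsub>G\<^esub> gen (Edge j k r) = gen (Edge j k r) \<otimes>\<^bsub>G\<^esub> gen s"
proof (rule gen_commute)
  show "(comm_word (letter s) (letter (Edge j k r)), []) \<in> graph_rels \<Gamma> v F"
  proof (cases s)
    case (Vert i r')
    show ?thesis unfolding graph_rels_def Let_def vert_indices_def[symmetric] Vert
      by (rule UnI1, rule UnI2) (use Vert assms vert_gens in blast)
  next
    case (Edge j' k' r')
    show ?thesis unfolding graph_rels_def Let_def vert_indices_def[symmetric] Edge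
      by (rule UnI2) (use Edge assms edge_gens in blast)
  qed
qed (use assms in \<open>simp_all add: edge_gens\<close>)

lemma graphical_induct [consumes 1, case_names one gen gen_inv]:
  assumes "x \<in> carrier G"
    and "P \<one>\<^bsub>G\<^esub>"
    and "\<And>s y. s \<in> graph_gens \<Gamma> v F \<Longrightarrow> y \<in> carrier G \<Longrightarrow> P y \<Longrightarrow> P (gen s \<otimes>\<^bsub>G\<^esub> y)"
    and "\<And>s y. s \<in> graph_gens \<Gamma> v F \<Longrightarrow> y \<in> carrier G \<Longrightarrow> P y \<Longrightarrow> P (inv\<^bsub>G\<^esub> gen s \<otimes>\<^bsub>G\<^esub> y)"
  shows "P x"
  using assms unfolding gen_def graphical_group_def by (rule presented_group_induct)

text \<open>An edge generator commutes with all generators, hence with their inverses and with all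
  products of these.\<close>

lemma Edge_central:
  assumes "(j, k) \<in> J" "r \<in> carrier F" "g \<in> carrier G"
  shows "gen (Edge j k r) \<otimes>\<^bsub>G\<^esub> g = g \<otimes>\<^bsub>G\<^esub> gen (Edge j k r)"
proof -
  let ?z = "gen (Edge j k r)"
  have z: "?z \<in> carrier G" using assms by (simp add: gen_closed edge_gens)
  show ?thesis
    using assms(3)
  proof (induction rule: graphical_induct)
    case one
    then show ?case using z by simp
  next
    case (gen s y)
    then show ?case
      using z gen_closed[OF gen(1)] Edge_commute_gen[OF assms(1,2) gen(1)]
      by (metis G.m_assoc)
  next
    case (gen_inv s y)
    have "?z \<otimes>\<^bsub>G\<^esub> inv\<^bsub>G\<^esub> gen s = inv\<^bsub>G\<^esub> gen s \<otimes>\<^bsub>G\<^esub> ?z"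
      using z gen_closed[OF gen_inv(1)] Edge_commute_gen[OF assms(1,2) gen_inv(1)]
      by (metis G.inv_closed G.inv_solve_left G.inv_solve_right G.m_assoc G.m_closed)
    then show ?case
      using z gen_closed[OF gen_inv(1)] gen_inv by (metis G.m_assoc G.inv_closed)
  qed
qed

text \<open>Additivity makes this element idempotent, and the only idempotent of a group is
  1.\<close>

lemma Vert_zero: "i \<in> I \<Longrightarrow> gen (Vert i \<zero>) = \<one>\<^bsub>G\<^esub>"
  using Vert_add[of i \<zero> \<zero>] gen_closed[of "Vert i \<zero>"] by (simp add: vert_gens)

lemma Edge_zero: "(j, k) \<in> J \<Longrightarrow> gen (Edge j k \<zero>) = \<one>\<^bsub>G\<^esub>"
  using Edge_add[of j k \<zero> \<zero>] gen_closed[of "Edge j k \<zero>"] by (simp add: edge_gens)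

lemma Vert_inv: "i \<in> I \<Longrightarrow> r \<in> carrier F \<Longrightarrow> inv\<^bsub>G\<^esub> gen (Vert i r) = gen (Vert i (\<ominus> r))"
  using Vert_add[of i "\<ominus> r" r] gen_closed[of "Vert i _"]
  by (intro G.inv_equality) (simp_all add: vert_gens Vert_zero l_neg)

lemma Edge_inv: "(j, k) \<in> J \<Longrightarrow> r \<in> carrier F \<Longrightarrow> inv\<^bsub>G\<^esub> gen (Edge j k r) = gen (Edge j k (\<ominus> r))"
  using Edge_add[of j k "\<ominus> r" r] gen_closed[of "Edge j k _"]
  by (intro G.inv_equality) (simp_all add: edge_gens Edge_zero l_neg)

section \<open>Normal forms in the graphical group\<close>

definition vlist :: "nat list"
  where "vlist = [1..<Suc (card (pverts \<Gamma>))]"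

text \<open>Any enumeration of \<open>J\<close> without repetition would do, as edge generators
  commute; for \<open>vlist\<close> the increasing order matters.\<close>

definition elist :: "(nat \<times> nat) list"
  where "elist = filter (\<lambda>e. e \<in> J) (List.product vlist vlist)"

lemma vlist: "sorted_wrt (<) vlist" "distinct vlist" "set vlist = I"
  unfolding vlist_def vert_indices_def by (rule sorted_wrt_upt, rule distinct_upt) auto

lemma elist: "distinct elist" "set elist = J"
  using J_subset vlist by (auto simp: elist_def distinct_product)

definition vprod :: "nat list \<Rightarrow> (nat \<Rightarrow> 'r) \<Rightarrow> 'r graph_gen gword set"
  where "vprod = slot_prod G (\<lambda>i r. gen (Vert i r))"

definition eprod :: "(nat \<times> nat) list \<Rightarrow> (nat \<times> nat \<Rightarrow> 'r) \<Rightarrow> 'r graph_gen gword set"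
  where "eprod = slot_prod G (\<lambda>e r. gen (Edge (fst e) (snd e) r))"

text \<open>Shown below to be central and closed under multiplication, this serves as the set
  \<open>C\<close> when vertex generators are collected.\<close>

definition edge_part :: "'r graph_gen gword set set"
  where "edge_part = {eprod elist b | b. b \<in> J \<rightarrow> carrier F}"

lemma vprod_closed: "set l \<subseteq> I \<Longrightarrow> a \<in> I \<rightarrow> carrier F \<Longrightarrow> vprod l a \<in> carrier G"
  unfolding vprod_def
  by (rule G.slot_prod_closed[of _ "carrier F"]) (auto simp: subset_iff vert_gens intro!: gen_closed)

lemma eprod_closed: "set l \<subseteq> J \<Longrightarrow> b \<in> J \<rightarrow> carrier F \<Longrightarrow> eprod l b \<in> carrier G"
  unfolding eprod_def
  by (rule G.slot_prod_closed[of _ "carrier F"]) (auto simp: subset_iff edge_gens intro!: gen_closed)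

lemma edge_part_subset: "edge_part \<subseteq> carrier G"
  using eprod_closed[of elist] elist by (auto simp: edge_part_def)

lemma one_edge_part: "\<one>\<^bsub>G\<^esub> \<in> edge_part"
proof -
  have "eprod elist (\<lambda>_. \<zero>) = \<one>\<^bsub>G\<^esub>"
    unfolding eprod_def using elist by (intro G.slot_prod_one) (auto simp: Edge_zero)
  moreover have "(\<lambda>_. \<zero>) \<in> J \<rightarrow> carrier F" by simp
  ultimately show ?thesis unfolding edge_part_def by (metis (mono_tags, lifting) mem_Collect_eq)
qed

text \<open>Collection with trivial \<open>C\<close>, since the edge generators commute
  exactly.\<close>

lemma Edge_mult_edge_part:
  assumes "(j, k) \<in> J" "r \<in> carrier F" "c \<in> edge_part"
  shows "gen (Edge j k r) \<otimes>\<^bsub>G\<^esub> c \<in> edge_part"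
proof -
  obtain b where b: "c = eprod elist b" "b \<in> J \<rightarrow> carrier F" using assms(3) by (auto simp: edge_part_def)
  let ?f = "\<lambda>e r. gen (Edge (fst e) (snd e) r)" and ?b = "b((j, k) := r \<oplus> b (j, k))"
  have "\<exists>d\<in>{\<one>\<^bsub>G\<^esub>}. ?f (j, k) r \<otimes>\<^bsub>G\<^esub> slot_prod G ?f elist b = slot_prod G ?f elist ?b \<otimes>\<^bsub>G\<^esub> d"
  proof (rule G.slot_prod_collect[where R = "carrier F"])
    show f: "?f e s \<in> carrier G" if "e \<in> set elist" "s \<in> carrier F" for e s
      using that elist by (simp add: gen_closed edge_gens)
    show "?f e s \<otimes>\<^bsub>G\<^esub> ?f e s' = ?f e (s \<oplus> s')"
      if "e \<in> set elist" "s \<in> carrier F" "s' \<in> carrier F" for e s s'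
      using that elist by (intro Edge_add) simp_all
    show "\<exists>d\<in>{\<one>\<^bsub>G\<^esub>}. ?f e s \<otimes>\<^bsub>G\<^esub> ?f e' s' = ?f e' s' \<otimes>\<^bsub>G\<^esub> ?f e s \<otimes>\<^bsub>G\<^esub> d"
      if "e \<in> set elist" "e' \<in> set elist" "s \<in> carrier F" "s' \<in> carrier F" for e e' s s'
      using Edge_central[of "fst e" "snd e" s "?f e' s'"] f that elist by simp
  qed (use assms b elist in simp_all)
  moreover have "?b \<in> J \<rightarrow> carrier F" using assms b by (auto simp: Pi_iff)
  ultimately show ?thesis
    using b(1) eprod_closed[OF eq_refl[OF elist(2)], of ?b] unfolding edge_part_def eprod_def by auto
qed

lemma Edge_edge_part:
  assumes "(j, k) \<in> J" "r \<in> carrier F"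
  shows "gen (Edge j k r) \<in> edge_part"
  using Edge_mult_edge_part[OF assms one_edge_part] assms by (simp add: gen_closed edge_gens)

lemma edge_part_induct [consumes 1, case_names one Edge]:
  assumes "c \<in> edge_part" and "P \<one>\<^bsub>G\<^esub>"
    and step: "\<And>j k r d. (j, k) \<in> J \<Longrightarrow> r \<in> carrier F \<Longrightarrow> d \<in> carrier G \<Longrightarrow> P d \<Longrightarrow>
      P (gen (Edge j k r) \<otimes>\<^bsub>G\<^esub> d)"
  shows "P c"
proof -
  obtain b where b: "c = eprod elist b" "b \<in> J \<rightarrow> carrier F" using assms(1) by (auto simp: edge_part_def)
  have "P (eprod l b)" if "set l \<subseteq> J" for l
    using that
  proof (induction l)
    case Nil
    then show ?case using assms(2) by (simp add: eprod_def)
  next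
    case (Cons e l)
    then have "P (gen (Edge (fst e) (snd e) (b e)) \<otimes>\<^bsub>G\<^esub> eprod l b)"
      using b eprod_closed by (intro step) auto
    then show ?case by (simp add: eprod_def)
  qed
  then show ?thesis using elist b by simp
qed

lemma edge_part_mult:
  assumes "c \<in> edge_part" "d \<in> edge_part"
  shows "c \<otimes>\<^bsub>G\<^esub> d \<in> edge_part"
  using assms(1)
proof (induction rule: edge_part_induct)
  case one
  then show ?case using assms(2) edge_part_subset by auto
next
  case (Edge j k r c)
  then show ?case
    using assms(2) edge_part_subset Edge_mult_edge_part[of j k r]
    by (auto simp: G.m_assoc gen_closed edge_gens)
qed

lemma edge_part_central:
  assumes "c \<in> edge_part" "g \<in> carrier G"
  shows "c \<otimes>\<^bsub>G\<^esub> g = g \<otimes>\<^bsub>G\<^esub> c"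
  using assms(1)
proof (induction rule: edge_part_induct)
  case one
  then show ?case using assms(2) by simp
next
  case (Edge j k r c)
  have z: "gen (Edge j k r) \<in> carrier G" using Edge by (simp add: gen_closed edge_gens)
  show ?case
    using z assms(2) Edge Edge_central[OF Edge(1,2) assms(2)] by (metis G.m_assoc)
qed

lemma Vert_comm_edge_part:
  assumes "i \<in> I" "i' \<in> I" "i \<noteq> i'" "r \<in> carrier F" "r' \<in> carrier F"
  shows "\<exists>c\<in>edge_part. gen (Vert i r) \<otimes>\<^bsub>G\<^esub> gen (Vert i' r') =
    gen (Vert i' r') \<otimes>\<^bsub>G\<^esub> gen (Vert i r) \<otimes>\<^bsub>G\<^esub> c"
proof -
  have X: "gen (Vert i r) \<in> carrier G" "gen (Vert i' r') \<in> carrier G"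
    using assms by (simp_all add: gen_closed vert_gens)
  consider "(v i, v i') \<notin> parcs \<Gamma>" | "(i, i') \<in> J" | "(i', i) \<in> J"
    using arc_J assms by blast
  then show ?thesis
  proof cases
    case 1
    then show ?thesis using assms X Vert_commute one_edge_part by (intro bexI[of _ "\<one>\<^bsub>G\<^esub>"]) simp_all
  next
    case 2
    then show ?thesis
      using Vert_comm[OF 2 assms(4,5)] Edge_edge_part[OF 2, of "r \<otimes> r'"] assms by auto
  next
    case 3
    \<comment> \<open>Here \<open>i' < i\<close>, so the relation exchanges the two factors in the
      opposite direction and its correction term has to be inverted.\<close>
    let ?c = "gen (Edge i' i (r' \<otimes> r))"
    have c: "?c \<in> carrier G" using 3 assms by (simp add: gen_closed edge_gens)
    have "gen (Vert i' r') \<otimes>\<^bsub>G\<^esub> gen (Vert i r) = gen (Vert i r) \<otimes>\<^bsub>G\<^esub> gen (Vert i' r') \<otimes>\<^bsub>G\<^esub> ?c"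
      by (rule Vert_comm[OF 3 assms(5,4)])
    then have "gen (Vert i r) \<otimes>\<^bsub>G\<^esub> gen (Vert i' r') =
        gen (Vert i' r') \<otimes>\<^bsub>G\<^esub> gen (Vert i r) \<otimes>\<^bsub>G\<^esub> inv\<^bsub>G\<^esub> ?c"
      using X c by (metis G.inv_solve_right G.m_closed)
    moreover have "inv\<^bsub>G\<^esub> ?c \<in> edge_part"
      using 3 assms by (simp add: Edge_inv Edge_edge_part)
    ultimately show ?thesis by blast
  qed
qed

lemma Vert_mult_vprod:
  assumes "i \<in> I" "r \<in> carrier F" "a \<in> I \<rightarrow> carrier F"
  shows "\<exists>c\<in>edge_part. gen (Vert i r) \<otimes>\<^bsub>G\<^esub> vprod vlist a =
    vprod vlist (a(i := r \<oplus> a i)) \<otimes>\<^bsub>G\<^esub> c"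
  unfolding vprod_def
proof (rule G.slot_prod_collect[where R = "carrier F"])
  show "s \<in> set vlist \<Longrightarrow> t \<in> set vlist \<Longrightarrow> s \<noteq> t \<Longrightarrow> r \<in> carrier F \<Longrightarrow> r' \<in> carrier F \<Longrightarrow>
    \<exists>c\<in>edge_part. gen (Vert s r) \<otimes>\<^bsub>G\<^esub> gen (Vert t r') =
      gen (Vert t r') \<otimes>\<^bsub>G\<^esub> gen (Vert s r) \<otimes>\<^bsub>G\<^esub> c" for s t r r'
    using Vert_comm_edge_part vlist(3) by blast
  show "c \<in> edge_part \<Longrightarrow> g \<in> carrier G \<Longrightarrow> c \<otimes>\<^bsub>G\<^esub> g = g \<otimes>\<^bsub>G\<^esub> c" for c g
    by (rule edge_part_central)
qed (use assms vlist edge_part_subset in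
  \<open>simp_all add: gen_closed vert_gens Vert_add one_edge_part edge_part_mult\<close>)

definition normal_forms :: "'r graph_gen gword set set"
  where "normal_forms = {vprod vlist a \<otimes>\<^bsub>G\<^esub> c | a c. a \<in> I \<rightarrow> carrier F \<and> c \<in> edge_part}"

text \<open>A vertex generator is collected into the vertex product, leaving a central correction;
  an edge generator passes through that product into the edge part.\<close>

lemma gen_mult_normal_forms:
  assumes "s \<in> graph_gens \<Gamma> v F" "y \<in> normal_forms"
  shows "gen s \<otimes>\<^bsub>G\<^esub> y \<in> normal_forms"
proof -
  obtain a c where y: "y = vprod vlist a \<otimes>\<^bsub>G\<^esub> c" "a \<in> I \<rightarrow> carrier F" "c \<in> edge_part"
    using assms(2) by (auto simp: normal_forms_def)
  have c: "c \<in> carrier G" using y edge_part_subset by blast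
  have p: "vprod vlist a \<in> carrier G" using y vprod_closed vlist(3) by blast
  have s: "gen s \<in> carrier G" using assms(1) by (rule gen_closed)
  show ?thesis
  proof (cases s)
    case (Vert i r)
    then have ir: "i \<in> I" "r \<in> carrier F" using assms(1) vert_gens by auto
    let ?a = "a(i := r \<oplus> a i)"
    obtain d where d: "d \<in> edge_part" "gen s \<otimes>\<^bsub>G\<^esub> vprod vlist a = vprod vlist ?a \<otimes>\<^bsub>G\<^esub> d"
      using Vert_mult_vprod[OF ir y(2)] Vert by blast
    have a: "?a \<in> I \<rightarrow> carrier F" using ir y(2) by (auto simp: Pi_iff)
    have "gen s \<otimes>\<^bsub>G\<^esub> y = gen s \<otimes>\<^bsub>G\<^esub> vprod vlist a \<otimes>\<^bsub>G\<^esub> c"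
      using s p c y by (simp add: G.m_assoc)
    also have "\<dots> = vprod vlist ?a \<otimes>\<^bsub>G\<^esub> (d \<otimes>\<^bsub>G\<^esub> c)"
      using d c edge_part_subset vprod_closed[OF _ a, of vlist] vlist(3)
      by (simp add: G.m_assoc subset_iff)
    finally show ?thesis
      using a edge_part_mult[OF d(1) y(3)] unfolding normal_forms_def by blast
  next
    case (Edge j k r)
    then have jkr: "(j, k) \<in> J" "r \<in> carrier F" using assms(1) edge_gens by auto
    have "gen s \<otimes>\<^bsub>G\<^esub> y = vprod vlist a \<otimes>\<^bsub>G\<^esub> (gen s \<otimes>\<^bsub>G\<^esub> c)"
      using s p c y Edge_central[OF jkr p] Edge by (metis G.m_assoc)
    moreover have "gen s \<otimes>\<^bsub>G\<^esub> c \<in> edge_part"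
      using Edge_mult_edge_part[OF jkr y(3)] Edge by simp
    ultimately show ?thesis using y(2) unfolding normal_forms_def by blast
  qed
qed

text \<open>The normal forms contain 1 and are stable under left multiplication by generators. The
  inverse of a generator is the generator with negated parameter, so this reaches every element.
  Uniqueness comes only from the map to \<open>heis\<close>.\<close>

lemma normal_form:
  assumes "g \<in> carrier G"
  shows "\<exists>a b. a \<in> I \<rightarrow> carrier F \<and> b \<in> J \<rightarrow> carrier F \<and> g = vprod vlist a \<otimes>\<^bsub>G\<^esub> eprod elist b"
proof -
  have "g \<in> normal_forms"
    using assms
  proof (induction rule: graphical_induct)
    case one
    have "vprod vlist (\<lambda>_. \<zero>) = \<one>\<^bsub>G\<^esub>"
      unfolding vprod_def using vlist(3) by (intro G.slot_prod_one) (simp add: Vert_zero)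
    then have "\<one>\<^bsub>G\<^esub> = vprod vlist (\<lambda>_. \<zero>) \<otimes>\<^bsub>G\<^esub> \<one>\<^bsub>G\<^esub>" by simp
    then show ?case using one_edge_part unfolding normal_forms_def by blast
  next
    case (gen s y)
    then show ?case by (intro gen_mult_normal_forms)
  next
    case (gen_inv s y)
    then have "\<exists>t \<in> graph_gens \<Gamma> v F. inv\<^bsub>G\<^esub> gen s = gen t"
      by (cases s) (auto simp: vert_gens edge_gens Vert_inv Edge_inv intro!: bexI)
    then show ?case using gen_inv gen_mult_normal_forms by auto
  qed
  then show ?thesis by (auto simp: normal_forms_def edge_part_def)
qed

text \<open>The universal property gives a homomorphism \<open>h\<close>, which sends the normal
  form with parameters \<open>a\<close>, \<open>b\<close> to the pair of their restrictions. As
  every element has a normal form, \<open>h\<close> is injective; surjectivity is immediate.\<close>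

lemma graphical_group_iso_heis: "\<exists>h. h \<in> iso G heis"
proof -
  have "\<exists>h\<in>hom G heis. \<forall>s\<in>graph_gens \<Gamma> v F.
      h (word_class (graph_gens \<Gamma> v F) (graph_rels \<Gamma> v F) (letter s)) = heis_gen s"
    unfolding graphical_group_def
    by (rule presented_group_universal)
      (auto simp: group_heis heis_gen_closed heis_gen_relations)
  then obtain h where h: "h \<in> hom G heis" "\<And>s. s \<in> graph_gens \<Gamma> v F \<Longrightarrow> h (gen s) = heis_gen s"
    by (auto simp: gen_def)
  interpret h: group_hom G heis h
    using h(1) by unfold_locales
  have hv: "h (vprod l a) = (\<lambda>i\<in>I. if i \<in> set l then a i else \<zero>, \<lambda>e\<in>J. \<zero>)"
    if "sorted_wrt (<) l" "set l \<subseteq> I" "a \<in> I \<rightarrow> carrier F" for l a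
    using that
  proof (induction l)
    case Nil
    then show ?case by (simp add: vprod_def one_heis restrict_def)
  next
    case (Cons i l)
    have l: "i \<in> I" "a i \<in> carrier F" "i \<notin> set l" "set l \<subseteq> I" "\<And>j. j \<in> set l \<Longrightarrow> i < j"
      using Cons.prems by auto
    have ac: "a j \<in> carrier F" if "j \<in> I" for j using that Cons.prems by auto
    have vi: "Vert i (a i) \<in> graph_gens \<Gamma> v F" using l by (simp add: vert_gens)
    have "h (vprod (i # l) a) = heis_gen (Vert i (a i)) \<otimes>\<^bsub>heis\<^esub> h (vprod l a)"
      using l vi vprod_closed[OF l(4) Cons.prems(3)] by (simp add: vprod_def h(2) gen_closed)
    also have "h (vprod l a) = (\<lambda>i\<in>I. if i \<in> set l then a i else \<zero>, \<lambda>e\<in>J. \<zero>)"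
      using Cons.prems by (intro Cons.IH) auto
    also have "heis_gen (Vert i (a i)) \<otimes>\<^bsub>heis\<^esub> \<dots> =
        (\<lambda>j\<in>I. if j \<in> set (i # l) then a j else \<zero>, \<lambda>e\<in>J. \<zero>)"
    proof -
      \<comment> \<open>As \<open>i\<close> precedes every index of \<open>l\<close>, no pair
        \<open>e\<close> in \<open>J\<close> ends in \<open>i\<close> and starts in
        \<open>l\<close>; the cocycle therefore vanishes in this product.\<close>
      have "\<not> (snd e = i \<and> fst e \<in> set l)" if "e \<in> J" for e
        using J_less[of "fst e" "snd e"] that l(5)[of "fst e"] by auto
      then show ?thesis
        using l J_mem ac by (auto simp: mult_heis heis_gen.simps a_minus_def intro!: restrict_ext)
    qed
    finally show ?case .
  qed
  have he: "h (eprod l b) = (\<lambda>i\<in>I. \<zero>, \<lambda>e\<in>J. if e \<in> set l then b e else \<zero>)"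
    if "distinct l" "set l \<subseteq> J" "b \<in> J \<rightarrow> carrier F" for l b
    using that
  proof (induction l)
    case Nil
    then show ?case by (simp add: eprod_def one_heis restrict_def)
  next
    case (Cons e l)
    have l: "e \<in> J" "b e \<in> carrier F" "e \<notin> set l" "set l \<subseteq> J"
      using Cons.prems by auto
    have bc: "b e' \<in> carrier F" if "e' \<in> J" for e' using that Cons.prems by auto
    have ei: "Edge (fst e) (snd e) (b e) \<in> graph_gens \<Gamma> v F" using l by (simp add: edge_gens)
    have "h (eprod (e # l) b) = heis_gen (Edge (fst e) (snd e) (b e)) \<otimes>\<^bsub>heis\<^esub> h (eprod l b)"
      using l ei eprod_closed[OF l(4) Cons.prems(3)] by (simp add: eprod_def h(2) gen_closed)
    also have "h (eprod l b) = (\<lambda>i\<in>I. \<zero>, \<lambda>e\<in>J. if e \<in> set l then b e else \<zero>)"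
      using Cons.prems by (intro Cons.IH) auto
    also have "heis_gen (Edge (fst e) (snd e) (b e)) \<otimes>\<^bsub>heis\<^esub> \<dots> =
        (\<lambda>i\<in>I. \<zero>, \<lambda>e'\<in>J. if e' \<in> set (e # l) then b e' else \<zero>)"
      using l J_mem bc by (auto simp: mult_heis heis_gen.simps a_minus_def intro!: restrict_ext)
    finally show ?case .
  qed
  have hn: "h (vprod vlist a \<otimes>\<^bsub>G\<^esub> eprod elist b) = (restrict a I, restrict b J)"
    if "a \<in> I \<rightarrow> carrier F" "b \<in> J \<rightarrow> carrier F" for a b
  proof -
    have "h (vprod vlist a) = (restrict a I, \<lambda>e\<in>J. \<zero>)"
      using hv[of vlist a] that vlist by (auto intro!: restrict_ext)
    moreover have "h (eprod elist b) = (\<lambda>i\<in>I. \<zero>, restrict b J)"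
      using he[of elist b] that elist by (auto intro!: restrict_ext)
    moreover have "a i \<in> carrier F" if "i \<in> I" for i using that \<open>a \<in> I \<rightarrow> carrier F\<close> by auto
    moreover have "b e \<in> carrier F" if "e \<in> J" for e using that \<open>b \<in> J \<rightarrow> carrier F\<close> by auto
    ultimately show ?thesis
      using that J_mem vprod_closed[of vlist a] eprod_closed[of elist b] vlist(3) elist
      by (auto simp: mult_heis heis_gen.simps a_minus_def intro!: restrict_ext)
  qed
  have "inj_on h (carrier G)"
  proof (rule inj_onI)
    fix g g' assume g: "g \<in> carrier G" "g' \<in> carrier G" "h g = h g'"
    obtain a b where ab: "a \<in> I \<rightarrow> carrier F" "b \<in> J \<rightarrow> carrier F"
      "g = vprod vlist a \<otimes>\<^bsub>G\<^esub> eprod elist b" using normal_form[OF g(1)] by blast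
    obtain a' b' where ab': "a' \<in> I \<rightarrow> carrier F" "b' \<in> J \<rightarrow> carrier F"
      "g' = vprod vlist a' \<otimes>\<^bsub>G\<^esub> eprod elist b'" using normal_form[OF g(2)] by blast
    \<comment> \<open>The ordered products use \<open>a\<close> on \<open>I\<close> and
      \<open>b\<close> on \<open>J\<close> only, so equal restrictions give equal group
      elements.\<close>
    have "restrict a I = restrict a' I" "restrict b J = restrict b' J"
      using g(3) hn ab ab' by auto
    moreover from this have "a i = a' i" if "i \<in> I" for i
      using that by (metis restrict_apply')
    moreover from calculation have "b e = b' e" if "e \<in> J" for e
      using that by (metis restrict_apply')
    ultimately have "vprod vlist a = vprod vlist a'" "eprod elist b = eprod elist b'"
      unfolding vprod_def eprod_def using vlist(3) elist
      by (auto intro!: slot_prod_cong)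
    then show "g = g'" using ab ab' by simp
  qed
  moreover have "carrier heis \<subseteq> h ` carrier G"
  proof
    fix p assume "p \<in> carrier heis"
    then obtain x z where p: "p = (x, z)" "x \<in> I \<rightarrow>\<^sub>E carrier F" "z \<in> J \<rightarrow>\<^sub>E carrier F"
      by (auto simp: carrier_heis)
    then have xz: "x \<in> I \<rightarrow> carrier F" "z \<in> J \<rightarrow> carrier F" by (auto simp: PiE_def)
    have "h (vprod vlist x \<otimes>\<^bsub>G\<^esub> eprod elist z) = p"
      using hn[OF xz] p by (simp add: PiE_restrict)
    moreover have "vprod vlist x \<otimes>\<^bsub>G\<^esub> eprod elist z \<in> carrier G"
      using xz vprod_closed eprod_closed vlist(3) elist by simp
    ultimately show "p \<in> h ` carrier G" by blast
  qed
  ultimately have "h \<in> iso G heis"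
    using h(1) by (auto simp: iso_def bij_betw_def hom_def)
  then show ?thesis by blast
qed

end


section \<open>The class-counting polynomials\<close>

lemma coeff_mult_nonneg:
  fixes p r :: "'a :: linordered_idom poly"
  assumes "\<And>k. coeff p k \<ge> 0" "\<And>k. coeff r k \<ge> 0"
  shows "coeff (p * r) k \<ge> 0"
  using assms by (simp add: coeff_mult sum_nonneg)

lemma coeff_power_nonneg:
  fixes p :: "'a :: linordered_idom poly"
  assumes "\<And>k. coeff p k \<ge> 0"
  shows "coeff (p ^ n) k \<ge> 0"
  by (induction n arbitrary: k) (auto intro: coeff_mult_nonneg assms)

theorem corollary3:
  fixes \<Gamma> :: "'v pair_pre_digraph" and v :: "nat \<Rightarrow> 'v" and i :: nat
  assumes "pair_graph \<Gamma>"
    and "pverts \<Gamma> \<noteq> {}"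
    and "bij_betw v {1..card (pverts \<Gamma>)} (pverts \<Gamma>)"
  shows "\<exists>g :: int poly.
    (\<forall>k. coeff g k \<ge> 0) \<and>
    (\<forall>(q :: nat) (F :: 'r ring).
      primepow q \<longrightarrow> field F \<longrightarrow> card (carrier F) = q \<longrightarrow>
      int (card {C \<in> conjugacy_classes (graphical_group \<Gamma> v F). card C = q ^ i}) =
        poly g (int q - 1))"
proof -
  let ?I = "vert_indices \<Gamma>" and ?J = "edge_indices \<Gamma> v"
  let ?P = "{S. S \<subseteq> ?I \<and> i + ann_dim ?I ?J S = card ?I}"
  \<comment> \<open>In the variable \<open>T = q - 1\<close>, the factor \<open>[:1, 1:]\<close> is
    \<open>1 + T = q\<close> and the monomial is \<open>T^|S|\<close>. The definition precedes the
    choice of \<open>q\<close> and \<open>F\<close>, so one polynomial serves all fields.\<close>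
  define g :: "int poly" where "g = (\<Sum>S\<in>?P. [:1, 1:] ^ (card ?J - i) * monom 1 (card S))"
  have "coeff [:1, 1 :: int:] k \<ge> 0" for k
    by (simp add: coeff_pCons split: nat.split)
  then have "coeff g k \<ge> 0" for k
    unfolding g_def coeff_sum by (intro sum_nonneg coeff_mult_nonneg coeff_power_nonneg) simp_all
  moreover have "int (card {C \<in> conjugacy_classes (graphical_group \<Gamma> v F). card C = q ^ i}) =
      poly g (int q - 1)"
    if "primepow q" "field F" "card (carrier F) = q" for q and F :: "'r ring"
  proof -
    \<comment> \<open>Since \<open>card\<close> of an infinite set is 0, positivity of
      \<open>q\<close> yields a finite carrier.\<close>
    have "q > 0" using that(1) by (simp add: primepow_gt_0_nat)
    then have "finite (carrier F)" using that(3) card_ge_0_finite by blast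
    moreover have "sym (parcs \<Gamma>)"
      using pair_sym_digraph.arcs_symmetric[of \<Gamma>] assms(1)
      by (auto simp: sym_def pair_graph_def pair_pseudo_graph_def)
    ultimately interpret graphical F \<Gamma> v
      using that(2) by (simp add: graphical_def graphical_axioms_def)
    obtain h where "h \<in> iso (graphical_group \<Gamma> v F) heis" using graphical_group_iso_heis by blast
    then have "card {C \<in> conjugacy_classes (graphical_group \<Gamma> v F). card C = q ^ i} =
        (\<Sum>S\<in>?P. q ^ (card ?J - i) * (q - 1) ^ card S)"
      using card_conjugacy_classes_iso[OF G.group_axioms group_heis] card_conjugacy_classes_heis that(3)
      by simp
    also have "int \<dots> = (\<Sum>S\<in>?P. int q ^ (card ?J - i) * (int q - 1) ^ card S)"
    proof -
      have "int (q - 1) = int q - 1" using \<open>q > 0\<close> by linarith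
      then show ?thesis by (simp only: of_nat_sum of_nat_mult of_nat_power)
    qed
    also have "\<dots> = poly g (int q - 1)"
      unfolding g_def poly_sum poly_mult poly_power poly_monom by simp
    finally show ?thesis .
  qed
  ultimately show ?thesis by blast
qed

end
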